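(* Every combinatorial incidence structure can be realized as a monotone quasi-topological incidence structure in the projective plane. Moreover, the order of the pseudolines that come to each point of the quasi-topological incidence structure may be prescribed: given, for every point $p$ of the combinatorial incidence structure, an arbitrary ordering of the lines incident with $p$, there is such a realization in which, at every point, the pseudolines through that point appear around it in the prescribed order.
   Context: A (combinatorial) incidence structure is a triple $\mathcal{C}=(\mathcal{P},\mathcal{L},\mathcal{I})$ with $\mathcal{P}$ (points) and $\mathcal{L}$ (lines) non-empty disjoint finite sets and $\mathcal{I}\subseteq\mathcal{P}\times\mathcal{L}$, such that each point lies on at least two lines and each line contains at least two points. Two incidence structures are isomorphic if there is an incidence-preserving bijection mapping points to points and lines to lines. The projective plane is the real projective plane, viewed as the extended Euclidean plane. A pseudoline is a simple non-contractible closed curve in the projective plane. A quasiline arrangement is a collection of at least two (finitely many) pseudolines such that any two of them have a finite number of points in common and cross transversally at each common point. Points where pseudolines meet are called crossings (several pseudolines may pass through one crossing). Standing assumptions on all quasiline arrangements: no crossing is a point at infinity, and every pseudoline of the arrangement intersects the line at infinity exactly once. Marked arrangements. Use the disk model of the projective plane: a closed disk with antipodal boundary points identified; the boundary is the line at infinity $\ell$. Let $\mathcal{A}$ be a quasiline arrangement, choose an orientation of $\ell$ and a point $x\in\ell$ not on any pseudoline of $\mathcal{A}$. Let $x^+,x^-$ be the two antipodal points on the boundary circle representing $x$. They divide the boundary circle into two arcs, $\ell^+$ from $x^+$ to $x^-$ and $\ell^-$ from $x^-$ to $x^+$. Orient each pseudoline of $\mathcal{A}$ from its endpoint on $\ell^+$,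 through the interior of the disk, to its antipodal endpoint on $\ell^-$. This is a marked arrangement $(\mathcal{A},x^+)$; it is proper if for any two pseudolines the order of their common intersection points is the same along both pseudolines. $\mathcal{A}$ is monotone if $(\mathcal{A},x^+)$ is proper for some choice of $x^+$. A quasi-topological incidence structure is an incidence structure whose lines are pseudolines forming a quasiline arrangement and whose points are a subset of the crossings of the arrangement, with incidence being containment. It is monotone if the underlying quasiline arrangement is monotone. It is a realization of a combinatorial incidence structure $\mathcal{C}$ if its underlying combinatorial incidence structure is isomorphic to $\mathcal{C}$ (points and lines are then identified via the isomorphism). Order around a point: if $L_1,\dots,L_r$ are the pseudolines through a point $p$ (which lies in the Euclidean plane), they appear around $p$ in the order $L_1,\dots,L_r$ if a small circle around $p$, traversed counterclockwise from a suitable starting point, meets them in the order $L_1,\dots,L_r,L_1,\dots,L_r$. *)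

theory Defs
  imports "HOL-Analysis.Analysis"
begin

section \<open>The real projective plane (disk model)\<close>

definition antipodal_rel :: "complex \<Rightarrow> complex \<Rightarrow> bool" where
  "antipodal_rel z w \<longleftrightarrow>
     norm z \<le> 1 \<and> norm w \<le> 1 \<and> (z = w \<or> norm z = 1 \<and> w = - z)"

lemma part_equivp_antipodal_rel: "part_equivp antipodal_rel"
proof (rule part_equivpI)
  show "\<exists>z. antipodal_rel z z"
    by (rule exI [of _ 0]) (simp add: antipodal_rel_def)
  show "symp antipodal_rel"
    by (rule sympI) (auto simp: antipodal_rel_def)
  show "transp antipodal_rel"
    by (rule transpI) (auto simp: antipodal_rel_def)
qed

text \<open>The map \<open>rp2_of\<close> is the identification map; its values outside the closed unit disk are
  irrelevant.  The open disk is the Euclidean plane with its usual orientation, and the boundary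
  circle becomes the line at infinity.\<close>

quotient_type rp2 = complex / partial: antipodal_rel
  morphisms rep_rp2 rp2_of
  by (rule part_equivp_antipodal_rel)

lemma rp2_of_eq_iff:
  assumes "z \<in> cball 0 1" "w \<in> cball 0 1"
  shows "rp2_of z = rp2_of w \<longleftrightarrow> z = w \<or> norm z = 1 \<and> w = - z"
proof -
  have "antipodal_rel z z" "antipodal_rel w w"
    using assms by (auto simp: antipodal_rel_def)
  then have "rp2_of z = rp2_of w \<longleftrightarrow> antipodal_rel z w"
    using Quotient3_rel [OF Quotient3_rp2] by blast
  then show ?thesis
    using assms by (auto simp: antipodal_rel_def)
qed

lemma rp2_of_surj: "rp2_of ` cball 0 1 = UNIV"
proof -
  have "p \<in> rp2_of ` cball 0 1" for p
  proof -
    have "antipodal_rel (rep_rp2 p) (rep_rp2 p)"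
      using Quotient3_rp2 by (rule Quotient3_rep_reflp)
    moreover have "rp2_of (rep_rp2 p) = p"
      using Quotient3_rp2 by (rule Quotient3_abs_rep)
    ultimately show ?thesis
      by (metis antipodal_rel_def image_eqI mem_cball_0)
  qed
  then show ?thesis by blast
qed

instantiation rp2 :: topological_space
begin

definition open_rp2 :: "rp2 set \<Rightarrow> bool" where
  "open_rp2 U \<longleftrightarrow> openin (top_of_set (cball 0 1)) {z \<in> cball 0 1. rp2_of z \<in> U}"

instance
proof
  have "{z \<in> cball 0 1. rp2_of z \<in> UNIV} = cball 0 1"
    by blast
  then show "open (UNIV :: rp2 set)"
    by (simp only: open_rp2_def openin_subtopology_self)
next
  fix S T :: "rp2 set"
  assume "open S" "open T"
  moreover have "{z \<in> cball 0 1. rp2_of z \<in> S \<inter> T} =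
      {z \<in> cball 0 1. rp2_of z \<in> S} \<inter> {z \<in> cball 0 1. rp2_of z \<in> T}"
    by blast
  ultimately show "open (S \<inter> T)"
    by (simp only: open_rp2_def openin_Int)
next
  fix K :: "rp2 set set"
  assume "\<forall>S\<in>K. open S"
  moreover have "{z \<in> cball 0 1. rp2_of z \<in> \<Union>K} = (\<Union>S\<in>K. {z \<in> cball 0 1. rp2_of z \<in> S})"
    by blast
  ultimately show "open (\<Union>K)"
    by (auto simp only: open_rp2_def intro!: openin_Union)
qed

end

lemma quotient_map_rp2_of: "quotient_map (top_of_set (cball 0 1)) euclidean rp2_of"
  by (simp add: quotient_map_def rp2_of_surj open_rp2_def)

definition line_at_infinity :: "rp2 set" where
  "line_at_infinity = rp2_of ` sphere 0 1"


section \<open>Quasiline arrangements\<close>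

definition contractible_loop :: "(real \<Rightarrow> rp2) \<Rightarrow> bool" where
  "contractible_loop g \<longleftrightarrow> (\<exists>a. homotopic_loops UNIV g (\<lambda>_. a))"

definition pseudoline :: "rp2 set \<Rightarrow> bool" where
  "pseudoline L \<longleftrightarrow>
     (\<exists>g. simple_path g \<and> pathfinish g = pathstart g \<and> \<not> contractible_loop g \<and> path_image g = L)"

text \<open>Topological transversality: in a suitable local chart around \<open>p\<close> the two curves are the
  coordinate axes.\<close>

definition cross_transversally_at :: "rp2 set \<Rightarrow> rp2 set \<Rightarrow> rp2 \<Rightarrow> bool" where
  "cross_transversally_at L M p \<longleftrightarrow>
     (\<exists>U (f :: rp2 \<Rightarrow> complex) f'. open U \<and> p \<in> U \<and> homeomorphism U UNIV f f' \<and> f p = 0 \<and>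
        f ` (U \<inter> L) = {z. Im z = 0} \<and> f ` (U \<inter> M) = {z. Re z = 0})"

definition crossings :: "rp2 set set \<Rightarrow> rp2 set" where
  "crossings A = {p. \<exists>L\<in>A. \<exists>M\<in>A. L \<noteq> M \<and> p \<in> L \<and> p \<in> M}"

text \<open>The last two conjuncts are the standing assumptions relative to the line at infinity.\<close>

definition quasiline_arrangement :: "rp2 set set \<Rightarrow> bool" where
  "quasiline_arrangement A \<longleftrightarrow>
     finite A \<and> card A \<ge> 2 \<and> (\<forall>L\<in>A. pseudoline L) \<and>
     (\<forall>L\<in>A. \<forall>M\<in>A. L \<noteq> M \<longrightarrow>
        finite (L \<inter> M) \<and> (\<forall>p\<in>L \<inter> M. cross_transversally_at L M p)) \<and>
     crossings A \<inter> line_at_infinity = {} \<and>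
     (\<forall>L\<in>A. \<exists>!p. p \<in> L \<inter> line_at_infinity)"


section \<open>Marked and monotone arrangements\<close>

text \<open>The sign \<open>\<sigma>\<close> is the chosen orientation of the line at infinity: \<open>1\<close> for counterclockwise,
  \<open>-1\<close> for clockwise.  Thus \<open>boundary_arc \<sigma> x\<close> is the open arc of the boundary circle
  from \<open>x\<close> to \<open>-x\<close>, so \<open>\<ell>\<^sup>+\<close> is \<open>boundary_arc \<sigma> x\<close> and \<open>\<ell>\<^sup>-\<close> is \<open>boundary_arc \<sigma> (- x)\<close> if
  \<open>x\<close> is the boundary point \<open>x\<^sup>+\<close>.\<close>

definition boundary_arc :: "real \<Rightarrow> complex \<Rightarrow> complex set" where
  "boundary_arc \<sigma> x = {x * cis (\<sigma> * t) | t. 0 < t \<and> t < pi}"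

definition marking :: "rp2 set set \<Rightarrow> real \<Rightarrow> complex \<Rightarrow> bool" where
  "marking A \<sigma> x \<longleftrightarrow> \<sigma> \<in> {1, -1} \<and> norm x = 1 \<and> rp2_of x \<notin> \<Union>A"

definition traversal :: "real \<Rightarrow> complex \<Rightarrow> rp2 set \<Rightarrow> (real \<Rightarrow> complex) \<Rightarrow> bool" where
  "traversal \<sigma> x L \<gamma> \<longleftrightarrow>
     arc \<gamma> \<and> pathstart \<gamma> \<in> boundary_arc \<sigma> x \<and>
     pathfinish \<gamma> \<in> boundary_arc \<sigma> (- x) \<and> pathfinish \<gamma> = - pathstart \<gamma> \<and>
     \<gamma> ` {0<..<1} \<subseteq> ball 0 1 \<and> rp2_of ` path_image \<gamma> = L"

text \<open>A traversal of \<open>L\<close> is unique up to an increasing reparametrization, so the choice of the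
  family \<open>\<gamma>\<close> does not matter.\<close>

definition proper_marked :: "rp2 set set \<Rightarrow> real \<Rightarrow> complex \<Rightarrow> bool" where
  "proper_marked A \<sigma> x \<longleftrightarrow>
     (\<exists>\<gamma>. (\<forall>L\<in>A. traversal \<sigma> x L (\<gamma> L)) \<and>
        (\<forall>L\<in>A. \<forall>M\<in>A. L \<noteq> M \<longrightarrow>
           (\<forall>s\<in>{0..1}. \<forall>t\<in>{0..1}. \<forall>s'\<in>{0..1}. \<forall>t'\<in>{0..1}.
              rp2_of (\<gamma> L s) = rp2_of (\<gamma> M s') \<and> rp2_of (\<gamma> L t) = rp2_of (\<gamma> M t') \<longrightarrow>
              (s < t \<longleftrightarrow> s' < t'))))"

definition monotone_arrangement :: "rp2 set set \<Rightarrow> bool" where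
  "monotone_arrangement A \<longleftrightarrow> (\<exists>\<sigma> x. marking A \<sigma> x \<and> proper_marked A \<sigma> x)"


section \<open>Incidence structures and their realizations\<close>

text \<open>Points and lines are taken from separate types, which makes them disjoint.\<close>

record ('p, 'l) incidence =
  points :: "'p set"
  lines :: "'l set"
  inc :: "('p \<times> 'l) set"

definition incidence_structure :: "('p, 'l) incidence \<Rightarrow> bool" where
  "incidence_structure C \<longleftrightarrow>
     finite (points C) \<and> points C \<noteq> {} \<and> finite (lines C) \<and> lines C \<noteq> {} \<and>
     inc C \<subseteq> points C \<times> lines C \<and>
     (\<forall>p\<in>points C. card {l. (p, l) \<in> inc C} \<ge> 2) \<and>
     (\<forall>l\<in>lines C. card {p. (p, l) \<in> inc C} \<ge> 2)"

definition incidence_isomorphism ::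
  "('p \<Rightarrow> 'q) \<Rightarrow> ('l \<Rightarrow> 'm) \<Rightarrow> ('p, 'l) incidence \<Rightarrow> ('q, 'm) incidence \<Rightarrow> bool" where
  "incidence_isomorphism f g C D \<longleftrightarrow>
     bij_betw f (points C) (points D) \<and> bij_betw g (lines C) (lines D) \<and>
     (\<forall>p\<in>points C. \<forall>l\<in>lines C. (p, l) \<in> inc C \<longleftrightarrow> (f p, g l) \<in> inc D)"

definition quasi_topological :: "(rp2, rp2 set) incidence \<Rightarrow> bool" where
  "quasi_topological D \<longleftrightarrow>
     incidence_structure D \<and> quasiline_arrangement (lines D) \<and>
     points D \<subseteq> crossings (lines D) \<and>
     inc D = {(p, L). p \<in> points D \<and> L \<in> lines D \<and> p \<in> L}"

definition monotone_quasi_topological :: "(rp2, rp2 set) incidence \<Rightarrow> bool" where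
  "monotone_quasi_topological D \<longleftrightarrow> quasi_topological D \<and> monotone_arrangement (lines D)"

text \<open>The pseudolines of \<open>A\<close> through \<open>p\<close> are \<open>Ls = [L\<^sub>1, \<dots>, L\<^sub>r]\<close>, and every sufficiently small
  circle around \<open>p\<close>, traversed once counterclockwise from the angle \<open>\<theta> 0\<close>, meets them exactly at
  the angles \<open>\<theta> 0 < \<dots> < \<theta> (2 * r - 1)\<close>, in the order \<open>L\<^sub>1, \<dots>, L\<^sub>r, L\<^sub>1, \<dots>, L\<^sub>r\<close>.\<close>

definition appear_around :: "rp2 set set \<Rightarrow> rp2 \<Rightarrow> rp2 set list \<Rightarrow> bool" where
  "appear_around A p Ls \<longleftrightarrow>
     distinct Ls \<and> set Ls = {L \<in> A. p \<in> L} \<and>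
     (\<exists>c. norm c < 1 \<and> rp2_of c = p \<and>
        (\<forall>\<^sub>F \<epsilon> in at_right 0. \<exists>\<theta> :: nat \<Rightarrow> real.
           strict_mono_on {..<2 * length Ls} \<theta> \<and>
           (\<forall>k<length Ls.
              {t \<in> {\<theta> 0..<\<theta> 0 + 2 * pi}. rp2_of (c + of_real \<epsilon> * cis t) \<in> Ls ! k} =
              {\<theta> k, \<theta> (k + length Ls)})))"

end

theory Submission
  imports Defs
begin

text \<open>
  In the Euclidean plane, the graph of a continuous function that is asymptotically linear, with
  the same slope at both ends, closes up to a pseudoline at the point at infinity given by this
  slope.  If the mark is placed at the
  vertical direction, every such curve is traversed in the direction of increasing abscissa, so a
  family of graphs is automatically proper: two graphs that meet twice meet in the order of the
  abscissas, which is the same order on both.  Hence monotonicity costs nothing, and what remains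
  is to choose functions whose graphs cross where they should, in the right local order, and
  otherwise transversally.

  Piecewise linear functions on the integer grid suffice.  Give the lines distinct slopes at
  infinity and, at every integer, distinct heights.  Then two of the functions never agree at a
  break point, and within a unit cell they are two affine functions that differ at the end
  points; so they agree at most once per cell, and there their graphs cross like two straight
  lines (\<open>transversal_tent_profiles\<close>).  The number of additional crossings does not matter.  Each
  point \<open>p\<close> of the incidence structure gets a cell of its own.  The lines through \<open>p\<close> join height
  \<open>- r\<close> to height \<open>r\<close> across this cell, where \<open>r\<close> is the position of the line in the prescribed
  order, so they all pass through the centre of the cell with slopes increasing in that order;
  the other lines cross the cell above them, each at a constant height of its own.

  The passage from plane to disk is a radial homeomorphism, chosen to be a homothety on a large
  disk that contains all points of the structure.  There the curves remain unions of straight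
  segments, and a small circle meets the lines through \<open>p\<close> at the arc tangents of their
  slopes (\<open>appear_around_graph_lines\<close>).  That the curves are not contractible follows by lifting
  paths to the double covering of the projective plane (\<open>antipodal_path_not_contractible\<close>), and local
  charts at crossings come from invariance of domain (\<open>cross_transversally_graph_lines\<close>).
\<close>

section \<open>Loops joining antipodal boundary points\<close>

text \<open>The image of the nonzero vectors consists of the positive semidefinite matrices of rank one.  Up to
  positive scaling, these form a model of the projective plane inside a normed vector space, where
  the lifting theorems for covering spaces apply; \<open>veronese\<close> itself is the double covering.\<close>

definition veronese :: "real^3 \<Rightarrow> real^3^3" where
  "veronese v = (\<chi> i j. v $ i * v $ j)"

lemma continuous_on_veronese: "continuous_on S veronese"
  unfolding veronese_def by (intro continuous_intros)

lemma veronese_uminus [simp]: "veronese (- v) = veronese v"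
  by (simp add: veronese_def)

lemma openin_veronese_chart:
  "openin (top_of_set (veronese ` (- {0}))) {m \<in> veronese ` (- {0}). m $ i $ i \<noteq> 0}"
proof -
  have "open {m :: real^3^3. m $ i $ i \<noteq> 0}"
    by (intro open_Collect_neq continuous_intros)
  then show ?thesis
    by (auto simp: openin_open)
qed

text \<open>Up to sign, a vector is recovered from the matrix of its products by dividing the \<open>i\<close>-th row by
  the square root of the \<open>i\<close>-th diagonal entry; restricting to a half space fixes the sign.\<close>

lemma homeomorphism_veronese_half_space:
  fixes a :: real
  assumes "a \<in> {1, -1}"
  shows "homeomorphism {v. 0 < a * v $ i} {m \<in> veronese ` (- {0}). m $ i $ i \<noteq> 0}
           veronese (\<lambda>m. (a / sqrt (m $ i $ i)) *\<^sub>R m $ i)"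
proof -
  have inverse: "(a / sqrt (veronese v $ i $ i)) *\<^sub>R veronese v $ i = v" if "0 < a * v $ i" for v
  proof -
    have "sqrt (v $ i * v $ i) = a * v $ i"
      using that assms by (auto simp: real_sqrt_mult_self)
    then show ?thesis
      using that assms by (auto simp: veronese_def vec_eq_iff)
  qed
  have surj: "m \<in> veronese ` {v. 0 < a * v $ i}"
    if m: "m \<in> veronese ` (- {0})" "m $ i $ i \<noteq> 0" for m
  proof -
    obtain v where v: "m = veronese v"
      using m(1) by blast
    then have "v $ i \<noteq> 0"
      using m(2) by (auto simp: veronese_def)
    then have "0 < a * v $ i \<or> 0 < a * (- v) $ i"
      using assms by auto
    then show ?thesis
      using v by (metis (mono_tags, lifting) imageI mem_Collect_eq veronese_uminus)
  qed
  have preimage: "\<exists>v. 0 < a * v $ i \<and> m = veronese v \<and> (a / sqrt (m $ i $ i)) *\<^sub>R m $ i = v"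
    if "m \<in> {m \<in> veronese ` (- {0}). m $ i $ i \<noteq> 0}" for m
  proof -
    from that have "m \<in> veronese ` {v. 0 < a * v $ i}"
      by (intro surj) simp_all
    then obtain v where "0 < a * v $ i" "m = veronese v"
      by (elim imageE) simp
    then show ?thesis
      using inverse [of v] by (intro exI [of _ v]) simp
  qed
  show ?thesis
  proof (rule homeomorphismI)
    show "continuous_on {v. 0 < a * v $ i} veronese"
      by (rule continuous_on_veronese)
    show "continuous_on {m \<in> veronese ` (- {0}). m $ i $ i \<noteq> 0} (\<lambda>m. (a / sqrt (m $ i $ i)) *\<^sub>R m $ i)"
      by (intro continuous_intros) simp
    show "veronese ` {v. 0 < a * v $ i} \<subseteq> {m \<in> veronese ` (- {0}). m $ i $ i \<noteq> 0}"
    proof (rule image_subsetI)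
      fix v assume "v \<in> {v. 0 < a * v $ i}"
      then have "v $ i \<noteq> 0"
        by auto
      then have "v \<noteq> 0" "veronese v $ i $ i \<noteq> 0"
        by (auto simp: veronese_def)
      then show "veronese v \<in> {m \<in> veronese ` (- {0}). m $ i $ i \<noteq> 0}"
        by blast
    qed
    show "(\<lambda>m. (a / sqrt (m $ i $ i)) *\<^sub>R m $ i) ` {m \<in> veronese ` (- {0}). m $ i $ i \<noteq> 0} \<subseteq> {v. 0 < a * v $ i}"
    proof (rule image_subsetI)
      fix m assume "m \<in> {m \<in> veronese ` (- {0}). m $ i $ i \<noteq> 0}"
      from preimage [OF this] show "(a / sqrt (m $ i $ i)) *\<^sub>R m $ i \<in> {v. 0 < a * v $ i}"
        by fastforce
    qed
    show "(a / sqrt (veronese v $ i $ i)) *\<^sub>R veronese v $ i = v" if "v \<in> {v. 0 < a * v $ i}" for v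
      using that by (intro inverse) simp
    show "veronese ((a / sqrt (m $ i $ i)) *\<^sub>R m $ i) = m"
      if "m \<in> {m \<in> veronese ` (- {0}). m $ i $ i \<noteq> 0}" for m
      using preimage [OF that] by metis
  qed
qed

lemma covering_space_veronese: "covering_space (- {0}) veronese (veronese ` (- {0}))"
proof (rule covering_spaceI)
  show "continuous_on (- {0}) veronese"
    by (rule continuous_on_veronese)
next
  fix m assume "m \<in> veronese ` (- {0})"
  then obtain v where v: "v \<noteq> 0" "m = veronese v"
    by auto
  then obtain i where "v $ i \<noteq> 0"
    by (metis vec_eq_iff zero_index)
  then have m: "m $ i $ i \<noteq> 0"
    using v by (simp add: veronese_def)
  let ?T = "{m \<in> veronese ` (- {0}). m $ i $ i \<noteq> 0}"
  let ?H = "\<lambda>a::real. {v :: real^3. 0 < a * v $ i}"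
  have opn: "open (?H a)" for a
    by (intro open_Collect_less continuous_intros)
  show "\<exists>t. m \<in> t \<and> openin (top_of_set (veronese ` (- {0}))) t \<and>
      (\<exists>v. \<Union>v = (- {0}) \<inter> veronese -` t \<and> (\<forall>u\<in>v. openin (top_of_set (- {0})) u) \<and>
        pairwise disjnt v \<and> (\<forall>u\<in>v. Ex (homeomorphism u t veronese)))"
  proof (intro exI [of _ ?T] exI [of _ "?H ` {1, -1}"] conjI ballI)
    show "m \<in> ?T"
      using m \<open>m \<in> _\<close> by simp
    show "openin (top_of_set (veronese ` (- {0}))) ?T"
      by (rule openin_veronese_chart)
    show "\<Union>(?H ` {1, -1}) = (- {0}) \<inter> veronese -` ?T"
      by (auto simp: veronese_def)
    show "pairwise disjnt (?H ` {1, -1})"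
      by (auto simp: pairwise_def disjnt_def)
  next
    fix u assume "u \<in> ?H ` {1, -1}"
    then obtain a where a: "a \<in> {1, -1}" "u = ?H a"
      by blast
    then show "openin (top_of_set (- {0})) u"
      using opn by (intro open_subset) auto
    show "Ex (homeomorphism u ?T veronese)"
      using homeomorphism_veronese_half_space [OF a(1)] a(2) by blast
  qed
qed (rule refl)

lemma continuous_on_rp2_lift:
  assumes "continuous_on (cball 0 1) h" "\<And>z. z \<in> cball 0 1 \<Longrightarrow> h z = g (rp2_of z)"
  shows "continuous_on (UNIV :: rp2 set) g"
proof -
  have "continuous_on (cball 0 1) (g \<circ> rp2_of)"
    using assms by (subst continuous_on_cong [OF refl, of _ _ h]) auto
  then have "continuous_map euclidean euclidean g"
    by (intro continuous_compose_quotient_map [OF quotient_map_rp2_of]) (simp add: continuous_map_iff_continuous)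
  then show ?thesis
    by simp
qed

lemma continuous_on_rp2_of: "continuous_on (cball 0 1) rp2_of"
  using quotient_imp_continuous_map [OF quotient_map_rp2_of]
  by simp

text \<open>This section of the vertical projection sends antipodal boundary points of the disk to opposite
  vectors, so that its composition with \<open>veronese\<close> factors through the projective plane.\<close>

definition hemisphere :: "complex \<Rightarrow> real^3" where
  "hemisphere z = vector [Re z, Im z, sqrt (1 - (norm z)\<^sup>2)]"

lemma hemisphere_nth [simp]:
  "hemisphere z $ 1 = Re z" "hemisphere z $ 2 = Im z" "hemisphere z $ 3 = sqrt (1 - (norm z)\<^sup>2)"
  by (simp_all add: hemisphere_def)

lemma continuous_on_hemisphere: "continuous_on S hemisphere"
  by (subst continuous_on_componentwise) (auto simp: forall_3 Basis_vec_def inner_axis intro!: continuous_intros)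

lemma hemisphere_nonzero: "hemisphere z \<noteq> 0"
proof
  assume "hemisphere z = 0"
  then have "Re z = 0" "Im z = 0" "sqrt (1 - (norm z)\<^sup>2) = 0"
    by (metis hemisphere_nth zero_index)+
  then show False
    by (simp add: cmod_def)
qed

lemma veronese_hemisphere_antipodal:
  assumes "norm z = 1" shows "veronese (hemisphere (- z)) = veronese (hemisphere z)"
proof -
  have "hemisphere (- z) = - hemisphere z"
    using assms by (simp add: vec_eq_iff forall_3)
  then show ?thesis
    by simp
qed

text \<open>The lift of the loop to the double covering runs from a vector to its opposite.  A
  null-homotopic loop would lift to a closed path by the monodromy theorem.\<close>

lemma antipodal_path_not_contractible:
  assumes "path \<gamma>" "path_image \<gamma> \<subseteq> cball 0 1"
    and "norm (pathstart \<gamma>) = 1" "pathfinish \<gamma> = - pathstart \<gamma>"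
  shows "\<not> contractible_loop (rp2_of \<circ> \<gamma>)"
proof
  define h where "h p = veronese (hemisphere (rep_rp2 p))" for p
  have h: "h (rp2_of z) = veronese (hemisphere z)" if "z \<in> cball 0 1" for z
  proof -
    have "antipodal_rel (rep_rp2 (rp2_of z)) z"
      using that Quotient3_rel [OF Quotient3_rp2] Quotient3_abs_rep [OF Quotient3_rp2]
        Quotient3_rep_reflp [OF Quotient3_rp2]
      by (metis antipodal_rel_def mem_cball_0)
    then show ?thesis
      unfolding h_def antipodal_rel_def using veronese_hemisphere_antipodal by fastforce
  qed
  have "continuous_on UNIV h"
  proof (rule continuous_on_rp2_lift)
    show "continuous_on (cball 0 1) (\<lambda>z. veronese (hemisphere z))"
      by (rule continuous_on_compose2 [OF continuous_on_veronese continuous_on_hemisphere subset_UNIV])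
  qed (simp add: h)
  assume "contractible_loop (rp2_of \<circ> \<gamma>)"
  then obtain a where "homotopic_loops UNIV (rp2_of \<circ> \<gamma>) (\<lambda>_. a)"
    by (auto simp: contractible_loop_def)
  then have hom: "homotopic_loops (veronese ` (- {0})) (h \<circ> (rp2_of \<circ> \<gamma>)) (h \<circ> (\<lambda>_. a))"
    by (rule homotopic_loops_continuous_image [OF _ \<open>continuous_on UNIV h\<close>])
      (auto simp: h_def hemisphere_nonzero)
  let ?m = "pathstart (h \<circ> (rp2_of \<circ> \<gamma>))"
  have null: "homotopic_paths (veronese ` (- {0})) (h \<circ> (rp2_of \<circ> \<gamma>)) (linepath ?m ?m)"
    using hom by (intro homotopic_loops_imp_homotopic_paths_null [of _ _ "h a"])
      (simp add: o_def linepath_refl)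
  have lift: "veronese ((hemisphere \<circ> \<gamma>) t) = (h \<circ> (rp2_of \<circ> \<gamma>)) t" if "t \<in> {0..1}" for t
    using that assms(2) h [of "\<gamma> t"] by (auto simp: path_image_def image_subset_iff)
  let ?v = "hemisphere (pathstart \<gamma>)"
  have m: "?m = veronese ?v"
    using lift [of 0] by (simp add: pathstart_def)
  have path: "path (hemisphere \<circ> \<gamma>)"
    using assms(1) continuous_on_hemisphere by (rule path_continuous_image)
  have range: "h p \<in> veronese ` (- {0})" for p
    by (simp add: h_def hemisphere_nonzero)
  have "pathfinish (hemisphere \<circ> \<gamma>) = pathfinish (linepath ?v ?v)"
    using homotopic_paths_imp_path [OF null] path range lift
    by (intro covering_space_monodromy [OF covering_space_veronese _ _ _ _ null])
      (auto simp: path_image_def hemisphere_nonzero pathstart_compose simp flip: m simp del: image_iff)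
  then have "hemisphere (- pathstart \<gamma>) = ?v"
    using assms(4) by (simp add: pathfinish_compose)
  then have "- pathstart \<gamma> = pathstart \<gamma>"
    by (metis complex_eqI hemisphere_nth(1,2))
  then show False
    using assms(3) by auto
qed

section \<open>Graphs as pseudolines\<close>

text \<open>The point of the disk that represents the point with homogeneous coordinates \<open>(w, z)\<close>, that is,
  \<open>z / w\<close> in the plane if \<open>w > 0\<close> and the direction \<open>z\<close> at infinity if \<open>w = 0\<close>.  The maximum in the
  denominator makes \<open>disk_point R 1\<close> linear on the disk of radius \<open>R\<close>, so that straight segments
  and circles there keep their shape; homogeneity makes the passage to infinity continuous.\<close>

definition disk_point :: "real \<Rightarrow> real \<Rightarrow> complex \<Rightarrow> complex" where
  "disk_point R w z = z /\<^sub>R max (2 * R * w) (R * w + norm z)"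

lemma disk_point_scale:
  assumes "0 < c"
  shows "disk_point R (c * w) (c *\<^sub>R z) = disk_point R w z"
proof -
  have "max (2 * R * (c * w)) (R * (c * w) + norm (c *\<^sub>R z)) = c * max (2 * R * w) (R * w + norm z)"
    using assms by (simp add: max_mult_distrib_left algebra_simps)
  then show ?thesis
    using assms by (simp add: disk_point_def)
qed

lemma disk_point_central: "norm z \<le> R \<Longrightarrow> disk_point R 1 z = z /\<^sub>R (2 * R)"
  by (simp add: disk_point_def max_def)

lemma norm_disk_point_less: "0 < R \<Longrightarrow> norm (disk_point R 1 z) < 1"
  by (simp add: disk_point_def max_def field_simps)

text \<open>The map is radial, and the radius \<open>a / max (2 * R) (R + a)\<close> of the image is strictly increasing in
  the radius \<open>a\<close> of the argument.\<close>

lemma inj_disk_point: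
  assumes "0 < R"
  shows "inj (disk_point R 1)"
proof (rule injI)
  fix z z' assume eq: "disk_point R 1 z = disk_point R 1 z'"
  let ?m = "\<lambda>a. max (2 * R) (R + a)"
  have pos: "0 < ?m a" for a
    using assms by auto
  have less: "a / ?m a < b / ?m b" if "0 \<le> a" "a < b" for a b
  proof -
    have "a * (2 * R) < b * (2 * R)" "a * (R + b) < b * (R + a)"
      using that assms by (auto simp: algebra_simps)
    moreover have "b * (2 * R) \<le> b * ?m a" "b * (R + a) \<le> b * ?m a"
      using that by (auto intro: mult_left_mono)
    ultimately have "a * ?m b < b * ?m a"
      unfolding max_def by (auto split: if_splits)
    then show ?thesis
      using pos [of a] pos [of b] by (simp only: divide_less_eq less_divide_eq times_divide_eq_left if_True)
  qed
  have "norm (disk_point R 1 z) = norm z / ?m (norm z)" for z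
    using pos [of "norm z"] by (simp add: disk_point_def divide_inverse mult.commute)
  then have "norm z / ?m (norm z) = norm z' / ?m (norm z')"
    using eq by metis
  then have "norm z = norm z'"
    using less by (metis less_irrefl linorder_neqE_linordered_idom norm_ge_zero)
  then show "z = z'"
    using eq pos [of "norm z"] assms by (simp add: disk_point_def)
qed

lemma rp2_of_disk_point_eq_iff:
  assumes "0 < R"
  shows "rp2_of (disk_point R 1 z) = rp2_of (disk_point R 1 z') \<longleftrightarrow> z = z'"
  using norm_disk_point_less [OF assms, of z] norm_disk_point_less [OF assms, of z']
    inj_disk_point [OF assms]
  by (auto simp: rp2_of_eq_iff dest: injD)

lemma continuous_on_disk_point:
  assumes "0 < R" "continuous_on S f" "continuous_on S g"
    and "\<And>x. x \<in> S \<Longrightarrow> 0 < f x \<or> 0 \<le> f x \<and> g x \<noteq> 0"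
  shows "continuous_on S (\<lambda>x. disk_point R (f x) (g x))"
proof -
  have "max (2 * R * f x) (R * f x + norm (g x)) \<noteq> 0" if "x \<in> S" for x
    using assms(4) [OF that] assms(1)
    by (smt (verit) mult_pos_pos mult_nonneg_nonneg norm_ge_zero zero_less_norm_iff)
  then show ?thesis
    unfolding disk_point_def using assms(2,3) by (intro continuous_intros) auto
qed

text \<open>The homogeneous form \<open>F w u = w * f (u / w)\<close> of a function \<open>f = F 1\<close> that is asymptotically linear
  with the same slope \<open>F 0 1\<close> at both ends; the graph of \<open>f\<close> extends to infinity by continuity.\<close>

definition projective_profile :: "(real \<Rightarrow> real \<Rightarrow> real) \<Rightarrow> bool" where
  "projective_profile F \<longleftrightarrow>
     continuous_on UNIV (\<lambda>(w, u). F w u) \<and> (\<forall>c\<ge>0. \<forall>w u. F (c * w) (c * u) = c * F w u) \<and>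
     F 0 (- 1) = - F 0 1"

text \<open>The abscissa \<open>u / w\<close> increases from minus to plus infinity as \<open>t\<close> runs from \<open>0\<close> to \<open>1\<close>.\<close>

definition graph_path :: "real \<Rightarrow> (real \<Rightarrow> real \<Rightarrow> real) \<Rightarrow> real \<Rightarrow> complex" where
  "graph_path R F t =
     (let u = 2 * t - 1; w = 1 - \<bar>u\<bar> in disk_point R w (Complex u (F w u)))"

definition graph_line :: "real \<Rightarrow> (real \<Rightarrow> real \<Rightarrow> real) \<Rightarrow> rp2 set" where
  "graph_line R F = rp2_of ` path_image (graph_path R F)"

text \<open>The right end of a graph of slope \<open>s\<close> on the boundary circle; the left end is antipodal to it.\<close>

definition end_point :: "real \<Rightarrow> complex" where
  "end_point s = sgn (Complex 1 s)"

lemma norm_end_point [simp]: "norm (end_point s) = 1"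
  by (simp add: end_point_def norm_sgn complex_eq_iff)

lemma Re_end_point: "0 < Re (end_point s)"
  unfolding end_point_def sgn_div_norm by (simp add: complex_eq_iff)

lemma end_point_eq_iff: "end_point s = end_point s' \<longleftrightarrow> s = s'"
proof
  assume eq: "end_point s = end_point s'"
  have "Im (end_point s) = s * Re (end_point s)" for s
    by (simp add: end_point_def sgn_div_norm)
  then show "s = s'"
    using eq Re_end_point [of s'] by (metis less_irrefl mult_right_cancel)
qed simp

lemma rp2_of_end_point_eq_iff: "rp2_of (end_point s) = rp2_of (end_point s') \<longleftrightarrow> s = s'"
  using Re_end_point [of s] Re_end_point [of s']
  by (auto simp: rp2_of_eq_iff end_point_eq_iff)

lemma graph_path_0:
  assumes "projective_profile F"
  shows "graph_path R F 0 = - end_point (F 0 1)"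
proof -
  have "Complex (- 1) (F 0 (- 1)) = - Complex 1 (F 0 1)"
    using assms by (simp add: projective_profile_def complex_eq_iff)
  moreover have "graph_path R F 0 = sgn (Complex (- 1) (F 0 (- 1)))"
    by (simp add: graph_path_def disk_point_def sgn_div_norm Let_def)
  ultimately show ?thesis
    by (simp only: end_point_def sgn_minus)
qed

lemma graph_path_1: "graph_path R F 1 = end_point (F 0 1)"
  by (simp add: graph_path_def end_point_def disk_point_def sgn_div_norm)

definition abscissa :: "real \<Rightarrow> real" where
  "abscissa t = (2 * t - 1) / (1 - \<bar>2 * t - 1\<bar>)"

lemma abscissa_inverse:
  assumes "0 < t" "t < 1"
  shows "2 * t - 1 = abscissa t / (1 + \<bar>abscissa t\<bar>)"
proof -
  let ?u = "2 * t - 1"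
  have w: "0 < 1 - \<bar>?u\<bar>"
    using assms by (auto simp: abs_if)
  then have "1 + \<bar>abscissa t\<bar> = 1 / (1 - \<bar>?u\<bar>)"
    unfolding abscissa_def by (simp add: abs_divide add_divide_eq_iff del: abs_diff_less_iff)
  then show ?thesis
    using w by (simp add: abscissa_def)
qed

lemma abscissa_inj:
  assumes "0 < s" "s < 1" "0 < t" "t < 1" "abscissa s = abscissa t"
  shows "s = t"
  using abscissa_inverse assms by (metis add_diff_cancel_right' diff_add_cancel mult_cancel_left zero_neq_numeral)

lemma abscissa_surj: "\<exists>t. 0 < t \<and> t < 1 \<and> abscissa t = x"
proof -
  define y where "y = x / (1 + \<bar>x\<bar>)"
  have "\<bar>y\<bar> = \<bar>x\<bar> / (1 + \<bar>x\<bar>)"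
    by (simp add: y_def abs_divide)
  then have w: "1 - \<bar>y\<bar> = 1 / (1 + \<bar>x\<bar>)"
    by (simp add: field_simps)
  have "2 * ((1 + y) / 2) - 1 = y"
    by (simp add: field_simps)
  then have "abscissa ((1 + y) / 2) = x"
    unfolding abscissa_def using w by (simp add: y_def)
  moreover have "0 < 1 - \<bar>y\<bar>"
    unfolding w by simp
  ultimately show ?thesis
    by (intro exI [of _ "(1 + y) / 2"]) auto
qed

lemma graph_path_interior:
  assumes "projective_profile F" "0 < t" "t < 1"
  shows "graph_path R F t = disk_point R 1 (Complex (abscissa t) (F 1 (abscissa t)))"
proof -
  define u w where "u = 2 * t - 1" and "w = 1 - \<bar>u\<bar>"
  have w: "0 < w"
    using assms by (auto simp: u_def w_def abs_if)
  have "F (w * 1) (w * (u / w)) = w * F 1 (u / w)"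
    using assms(1) w unfolding projective_profile_def by (meson less_imp_le)
  then have "Complex u (F w u) = w *\<^sub>R Complex (u / w) (F 1 (u / w))"
    using w by (simp add: complex_eq_iff)
  then show ?thesis
    using disk_point_scale [OF w, of R 1] w by (simp add: graph_path_def Let_def abscissa_def u_def w_def)
qed

lemma path_graph_path:
  assumes "0 < R" "projective_profile F"
  shows "path (graph_path R F)"
proof -
  have F: "continuous_on S (\<lambda>x. F (f x) (g x))"
    if "continuous_on S f" "continuous_on S g" for S and f g :: "real \<Rightarrow> real"
    using continuous_on_compose2 [of UNIV "\<lambda>(w, u). F w u" S "\<lambda>x. (f x, g x)"] assms(2) that
    by (simp add: projective_profile_def continuous_on_Pair)
  show ?thesis
    unfolding path_def graph_path_def Let_def Complex_eq
    using assms(1)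
    by (intro continuous_on_disk_point continuous_intros F) (auto simp: complex_eq_iff abs_if)
qed

lemma norm_graph_path_less:
  assumes "0 < R" "projective_profile F" "0 < t" "t < 1"
  shows "norm (graph_path R F t) < 1"
  using assms by (simp add: graph_path_interior norm_disk_point_less)

lemma norm_graph_path_le:
  assumes "0 < R" "projective_profile F" "t \<in> {0..1}"
  shows "norm (graph_path R F t) \<le> 1"
  using assms norm_graph_path_less [of R F t]
  by (cases "t = 0"; cases "t = 1") (auto simp: graph_path_0 graph_path_1)

text \<open>This is why graphs form proper arrangements: a common point has a single abscissa, and the
  parameter of a graph path is a function of the abscissa that does not depend on the graph.  The
  exception is the point at infinity, which is reached at both ends.\<close>

lemma graph_path_meet:
  assumes R: "0 < R" and F: "projective_profile F" and G: "projective_profile G"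
    and st: "s \<in> {0..1}" "t \<in> {0..1}"
    and eq: "rp2_of (graph_path R F s) = rp2_of (graph_path R G t)"
  shows "s = t \<or> F 0 1 = G 0 1 \<and> {s, t} = {0, 1}"
proof -
  have *: "graph_path R F s = graph_path R G t \<or>
      norm (graph_path R F s) = 1 \<and> graph_path R G t = - graph_path R F s"
    using eq st norm_graph_path_le [OF R F] norm_graph_path_le [OF R G]
    by (subst (asm) rp2_of_eq_iff) auto
  consider "0 < s \<and> s < 1 \<and> 0 < t \<and> t < 1" | "s \<in> {0, 1} \<and> t \<in> {0, 1}" |
    "0 < s \<and> s < 1 \<and> t \<in> {0, 1}" | "s \<in> {0, 1} \<and> 0 < t \<and> t < 1"
    using st by (auto simp: less_le)
  then show ?thesis
  proof cases
    case 1
    then have "disk_point R 1 (Complex (abscissa s) (F 1 (abscissa s))) =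
        disk_point R 1 (Complex (abscissa t) (G 1 (abscissa t)))"
      using * norm_graph_path_less [OF R F, of s] F G by (simp add: graph_path_interior)
    then have "abscissa s = abscissa t"
      using inj_disk_point [OF R] by (auto dest: injD)
    then show ?thesis
      using abscissa_inj 1 by blast
  next
    case 2
    then show ?thesis
      using * Re_end_point [of "F 0 1"] Re_end_point [of "G 0 1"]
      by (auto simp: graph_path_0 [OF F] graph_path_0 [OF G] graph_path_1 end_point_eq_iff
          dest: arg_cong [where f = Re])
  next
    case 3
    then show ?thesis
      using * norm_graph_path_less [OF R F, of s]
      by (auto simp: graph_path_0 [OF G] graph_path_1 dest: arg_cong [where f = norm])
  next
    case 4
    then show ?thesis
      using * norm_graph_path_less [OF R G, of t]
      by (auto simp: graph_path_0 [OF F] graph_path_1 dest: arg_cong [where f = norm])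
  qed
qed

lemma arc_graph_path:
  assumes "0 < R" "projective_profile F"
  shows "arc (graph_path R F)"
  unfolding arc_def
proof (intro conjI inj_onI)
  fix s t assume st: "s \<in> {0..1}" "t \<in> {0..1}" and eq: "graph_path R F s = graph_path R F t"
  have "graph_path R F 0 \<noteq> graph_path R F 1"
    using Re_end_point [of "F 0 1"]
    by (auto simp: graph_path_0 [OF assms(2)] graph_path_1 dest: arg_cong [where f = Re])
  then show "s = t"
    using graph_path_meet [OF assms assms(2) st] eq by (auto simp: doubleton_eq_iff)
qed (rule path_graph_path [OF assms])

lemma pseudoline_graph_line:
  assumes R: "0 < R" and F: "projective_profile F"
  shows "pseudoline (graph_line R F)"
  unfolding pseudoline_def
proof (intro exI conjI)
  let ?g = "rp2_of \<circ> graph_path R F"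
  have im: "path_image (graph_path R F) \<subseteq> cball 0 1"
    using norm_graph_path_le [OF R F] by (auto simp: path_image_def)
  have "path ?g"
    using path_graph_path [OF R F] continuous_on_rp2_of im
    by (metis continuous_on_subset path_continuous_image)
  moreover have "loop_free ?g"
    unfolding loop_free_def using graph_path_meet [OF R F F] by (fastforce simp: doubleton_eq_iff)
  ultimately show "simple_path ?g"
    by (simp add: simple_path_def)
  have neg: "pathfinish (graph_path R F) = - pathstart (graph_path R F)"
    by (simp add: pathfinish_def pathstart_def graph_path_0 [OF F] graph_path_1)
  have norm1: "norm (pathstart (graph_path R F)) = 1"
    by (simp add: pathstart_def graph_path_0 [OF F])
  show "pathfinish ?g = pathstart ?g"
    using norm1 by (simp add: pathfinish_compose pathstart_compose neg rp2_of_eq_iff)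
  show "\<not> contractible_loop ?g"
    by (rule antipodal_path_not_contractible [OF path_graph_path [OF R F] im norm1 neg])
  show "path_image ?g = graph_line R F"
    by (simp add: graph_line_def path_image_compose)
qed

lemma affine_point_in_graph_line_iff:
  assumes R: "0 < R" and F: "projective_profile F"
  shows "rp2_of (disk_point R 1 z) \<in> graph_line R F \<longleftrightarrow> Im z = F 1 (Re z)"
proof
  assume "Im z = F 1 (Re z)"
  then have z: "z = Complex (Re z) (F 1 (Re z))"
    by (simp add: complex_eq_iff)
  obtain t where t: "0 < t" "t < 1" "abscissa t = Re z"
    using abscissa_surj by blast
  then have "disk_point R 1 z = graph_path R F t"
    using z graph_path_interior [OF F t(1,2), of R] by simp
  then show "rp2_of (disk_point R 1 z) \<in> graph_line R F"
    using t by (auto simp: graph_line_def path_image_def)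
next
  assume "rp2_of (disk_point R 1 z) \<in> graph_line R F"
  then obtain t where t: "t \<in> {0..1}" "rp2_of (disk_point R 1 z) = rp2_of (graph_path R F t)"
    by (auto simp: graph_line_def path_image_def)
  have less: "norm (disk_point R 1 z) < 1"
    using R by (rule norm_disk_point_less)
  then have eq: "disk_point R 1 z = graph_path R F t"
    using t norm_graph_path_le [OF R F t(1)] by (subst (asm) rp2_of_eq_iff) auto
  have "t \<noteq> 0" "t \<noteq> 1"
    using eq less by (auto simp: graph_path_0 [OF F] graph_path_1)
  then have "disk_point R 1 z = disk_point R 1 (Complex (abscissa t) (F 1 (abscissa t)))"
    using eq t(1) graph_path_interior [OF F, of t R] by simp
  then have "z = Complex (abscissa t) (F 1 (abscissa t))"
    by (rule injD [OF inj_disk_point [OF R]])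
  then show "Im z = F 1 (Re z)"
    by simp
qed

lemma graph_line_at_infinity:
  assumes R: "0 < R" and F: "projective_profile F"
  shows "graph_line R F \<inter> line_at_infinity = {rp2_of (end_point (F 0 1))}"
proof -
  have "p = rp2_of (end_point (F 0 1))" if p: "p \<in> graph_line R F" "p \<in> line_at_infinity" for p
  proof -
    obtain t where t: "t \<in> {0..1}" "p = rp2_of (graph_path R F t)"
      using p by (auto simp: graph_line_def path_image_def)
    obtain z where z: "norm z = 1" "p = rp2_of z"
      using p by (auto simp: line_at_infinity_def)
    have "graph_path R F t = z \<or> norm (graph_path R F t) = 1 \<and> z = - graph_path R F t"
      using t z norm_graph_path_le [OF R F t(1)] by (metis eq_iff mem_cball_0 rp2_of_eq_iff)
    then have "norm (graph_path R F t) = 1"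
      using z by auto
    then have "t = 0 \<or> t = 1"
      using t(1) norm_graph_path_less [OF R F, of t] by force
    moreover have "rp2_of (- end_point (F 0 1)) = rp2_of (end_point (F 0 1))"
      by (simp add: rp2_of_eq_iff)
    ultimately show ?thesis
      using t(2) by (auto simp: graph_path_0 [OF F] graph_path_1)
  qed
  moreover have "rp2_of (end_point (F 0 1)) \<in> graph_line R F"
    unfolding graph_line_def path_image_def graph_path_1 [of R F, symmetric] by simp
  moreover have "rp2_of (end_point (F 0 1)) \<in> line_at_infinity"
    by (simp add: line_at_infinity_def)
  ultimately show ?thesis
    by blast
qed

text \<open>With \<open>\<i>\<close> as mark, the counterclockwise arc from the mark is the left half of the circle, where
  all graphs start.\<close>

lemma boundary_arc_left:
  assumes "norm z = 1" "Re z < 0"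
  shows "z \<in> boundary_arc 1 \<i>"
proof -
  have circle: "(Re z)\<^sup>2 + (Im z)\<^sup>2 = 1"
    using assms(1) by (simp add: cmod_def)
  then have "(Im z)\<^sup>2 < 1"
    using assms(2) by (smt (verit) zero_less_power2)
  then have Im: "- 1 < Im z" "Im z < 1"
    by (auto simp: power2_less_1_iff abs_less_iff)
  have "1 - (Im z)\<^sup>2 = (Re z)\<^sup>2"
    using circle by simp
  then have "sin (arccos (Im z)) = - Re z"
    using Im assms(2) by (simp add: sin_arccos)
  then have "z = \<i> * cis (1 * arccos (Im z))"
    using Im by (simp add: complex_eq_iff)
  then show ?thesis
    unfolding boundary_arc_def using arccos_lt_bounded [OF Im] by blast
qed

lemma boundary_arc_uminus: "z \<in> boundary_arc \<sigma> (- x) \<longleftrightarrow> - z \<in> boundary_arc \<sigma> x"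
proof -
  have "z = - x * w \<longleftrightarrow> - z = x * w" for w
    by (metis minus_minus mult_minus_left)
  then show ?thesis
    by (simp only: boundary_arc_def mem_Collect_eq)
qed

lemma traversal_graph_path:
  assumes R: "0 < R" and F: "projective_profile F"
  shows "traversal 1 \<i> (graph_line R F) (graph_path R F)"
proof -
  have "- end_point (F 0 1) \<in> boundary_arc 1 \<i>"
    using Re_end_point [of "F 0 1"] by (intro boundary_arc_left) auto
  then show ?thesis
    using arc_graph_path [OF R F] norm_graph_path_less [OF R F]
    by (auto simp: traversal_def pathstart_def pathfinish_def graph_path_0 [OF F] graph_path_1
        boundary_arc_uminus graph_line_def)
qed

section \<open>Transversal crossings of graphs\<close>

lemma open_rp2_of_image:
  assumes "open V" "V \<subseteq> ball 0 1"
  shows "open (rp2_of ` V)"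
proof -
  have "w \<in> V" if "w \<in> cball 0 1" "z \<in> V" "rp2_of w = rp2_of z" for w z
  proof -
    have "norm z < 1"
      using that(2) assms(2) by auto
    then show ?thesis
      using that by (auto simp: rp2_of_eq_iff)
  qed
  then have "{w \<in> cball 0 1. rp2_of w \<in> rp2_of ` V} = V"
    using assms(2) by force
  then show ?thesis
    using assms by (force simp: open_rp2_def intro: open_subset)
qed

text \<open>Away from the boundary the identification map is an open embedding, so invariance of domain in the
  plane yields charts of the projective plane without an explicit inverse.\<close>

lemma open_embedding_into_rp2:
  fixes G :: "complex \<Rightarrow> complex"
  assumes "continuous_on UNIV G" "inj G" "range G \<subseteq> ball 0 1"
  obtains f where "open (range (rp2_of \<circ> G))" "homeomorphism (range (rp2_of \<circ> G)) UNIV f (rp2_of \<circ> G)"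
proof -
  have opn: "open ((rp2_of \<circ> G) ` U)" if "open U" for U
  proof -
    have "open (G ` U)"
    proof (rule invariance_of_domain)
      show "continuous_on U G" "inj_on G U"
        using continuous_on_subset [OF assms(1)] inj_on_subset [OF assms(2)] by auto
    qed (rule that)
    then show ?thesis
      using assms(3) open_rp2_of_image [of "G ` U"] by (auto simp: image_comp)
  qed
  have "continuous_on UNIV (rp2_of \<circ> G)"
    using assms by (intro continuous_on_compose continuous_on_subset [OF continuous_on_rp2_of]) auto
  moreover have "inj (rp2_of \<circ> G)"
  proof (rule injI)
    fix x y assume "(rp2_of \<circ> G) x = (rp2_of \<circ> G) y"
    moreover have "norm (G x) < 1" "norm (G y) < 1"
      using assms(3) by (auto simp: image_subset_iff)
    ultimately have "G x = G y"
      by (auto simp: rp2_of_eq_iff)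
    then show "x = y"
      using assms(2) by (auto dest: injD)
  qed
  moreover have "openin (top_of_set (range (rp2_of \<circ> G))) ((rp2_of \<circ> G) ` U)"
    if "openin (top_of_set UNIV) U" for U
    using that opn by (intro open_subset) auto
  ultimately obtain f where "homeomorphism UNIV (range (rp2_of \<circ> G)) (rp2_of \<circ> G) f"
    using homeomorphism_injective_open_map [of UNIV "rp2_of \<circ> G" "range (rp2_of \<circ> G)"] by blast
  then show ?thesis
    using that opn [of UNIV] homeomorphism_symD by blast
qed

text \<open>The chart in the definition of transversality has the whole plane as its range.  This shrinks
  each axis to an interval, so that such a chart fits into a neighbourhood of a crossing.\<close>

definition squash :: "real \<Rightarrow> real" where
  "squash u = u / (1 + \<bar>u\<bar>)"

lemma squash_eq_0_iff [simp]: "squash u = 0 \<longleftrightarrow> u = 0"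
  by (auto simp: squash_def)

lemma abs_squash_less_1: "\<bar>squash u\<bar> < 1"
  by (simp add: squash_def abs_divide)

lemma inj_squash: "inj squash"
proof (rule injI)
  fix u v assume eq: "squash u = squash v"
  have "u = squash u / (1 - \<bar>squash u\<bar>)" for u
  proof -
    have "1 - \<bar>squash u\<bar> = 1 / (1 + \<bar>u\<bar>)"
      by (simp add: squash_def abs_divide field_simps)
    then show ?thesis
      by (simp add: squash_def)
  qed
  then show "u = v"
    using eq by metis
qed

text \<open>Near the crossing the two graphs are straight lines with slopes \<open>a\<close> and \<open>b\<close>.  The vertical
  distances to them are linear coordinates there, and in these coordinates the graphs are the
  axes.\<close>

lemma cross_transversally_graph_lines:
  assumes R: "0 < R" and F: "projective_profile F" and G: "projective_profile G"
    and \<delta>: "0 < \<delta>" and ab: "a \<noteq> b"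
    and F_affine: "\<And>x'. \<bar>x' - x\<bar> < \<delta> \<Longrightarrow> F 1 x' = y + a * (x' - x)"
    and G_affine: "\<And>x'. \<bar>x' - x\<bar> < \<delta> \<Longrightarrow> G 1 x' = y + b * (x' - x)"
  shows "cross_transversally_at (graph_line R F) (graph_line R G) (rp2_of (disk_point R 1 (Complex x y)))"
proof -
  define e where "e = \<delta> * \<bar>a - b\<bar> / 2"
  have e: "0 < e"
    using \<delta> ab by (simp add: e_def)
  \<comment> \<open>\<open>S z\<close> is the point at height \<open>e * squash (Im z)\<close> above the line of slope \<open>a\<close> and at height
    \<open>e * squash (Re z)\<close> above the line of slope \<open>b\<close>; this forces the horizontal offset \<open>h z\<close>.  The
    size of \<open>e\<close> keeps the offset below \<open>\<delta>\<close>.\<close>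
  define h where "h z = e * (squash (Re z) - squash (Im z)) / (a - b)" for z
  define S where "S z = Complex (x + h z) (y + a * h z + e * squash (Im z))" for z
  have "\<bar>squash (Re z) - squash (Im z)\<bar> < 2" for z
    using abs_squash_less_1 [of "Re z"] abs_squash_less_1 [of "Im z"] by linarith
  then have h: "\<bar>h z\<bar> < \<delta>" for z
  proof -
    have "\<bar>h z\<bar> = \<delta> / 2 * \<bar>squash (Re z) - squash (Im z)\<bar>"
      unfolding h_def e_def abs_mult abs_divide using \<delta> ab by simp
    then show ?thesis
      using \<delta> mult_strict_left_mono [OF \<open>\<bar>squash (Re z) - squash (Im z)\<bar> < 2\<close>, of "\<delta> / 2"] by linarith
  qed
  have h_eq: "(a - b) * h z = e * squash (Re z) - e * squash (Im z)" for z
  proof -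
    have "(a - b) * h z = e * (squash (Re z) - squash (Im z))"
      using ab by (simp add: h_def)
    then show ?thesis
      by (simp only: right_diff_distrib)
  qed
  have "continuous_on UNIV S"
    unfolding S_def h_def squash_def Complex_eq by (intro continuous_intros) (use ab in auto)
  moreover have "inj S"
  proof (rule injI)
    fix z z' assume S_same: "S z = S z'"
    then have h_same: "h z = h z'"
      by (simp add: S_def)
    have Im_same: "e * squash (Im z) = e * squash (Im z')"
      using arg_cong [OF S_same, of Im] unfolding S_def complex.sel h_same by linarith
    moreover have "e * squash (Re z) = e * squash (Re z')"
      using h_eq [of z] h_eq [of z'] Im_same unfolding h_same by linarith
    ultimately show "z = z'"
      using e inj_squash by (auto simp: complex_eq_iff dest: injD)
  qed
  ultimately have "continuous_on UNIV (disk_point R 1 \<circ> S)"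
    unfolding o_def using R by (intro continuous_on_disk_point) simp_all
  moreover have "inj (disk_point R 1 \<circ> S)"
    using inj_disk_point [OF R] \<open>inj S\<close> by (rule inj_compose)
  moreover have "range (disk_point R 1 \<circ> S) \<subseteq> ball 0 1"
    using norm_disk_point_less [OF R] by (simp add: image_subset_iff)
  ultimately obtain f where opn: "open (range (rp2_of \<circ> (disk_point R 1 \<circ> S)))"
    and hom: "homeomorphism (range (rp2_of \<circ> (disk_point R 1 \<circ> S))) UNIV f (rp2_of \<circ> (disk_point R 1 \<circ> S))"
    by (rule open_embedding_into_rp2)
  let ?q = "rp2_of \<circ> (disk_point R 1 \<circ> S)"
  have f: "f (?q z) = z" for z
    using hom by (simp add: homeomorphism_def)
  have in_F: "?q z \<in> graph_line R F \<longleftrightarrow> Im z = 0" for z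
    using affine_point_in_graph_line_iff [OF R F, of "S z"] F_affine [of "x + h z"] h [of z] e
    by (simp add: S_def)
  have in_G: "?q z \<in> graph_line R G \<longleftrightarrow> Re z = 0" for z
    using affine_point_in_graph_line_iff [OF R G, of "S z"] G_affine [of "x + h z"] h [of z] e h_eq [of z]
    by (simp add: S_def) (auto simp: algebra_simps)
  have image: "f ` (range ?q \<inter> A) = {z. ?q z \<in> A}" for A
  proof (intro equalityI subsetI)
    fix z assume "z \<in> f ` (range ?q \<inter> A)"
    then obtain z' where "?q z' \<in> A" "z = f (?q z')"
      by blast
    then show "z \<in> {z. ?q z \<in> A}"
      unfolding f by (simp only: mem_Collect_eq)
  next
    fix z assume "z \<in> {z. ?q z \<in> A}"
    then have "?q z \<in> range ?q \<inter> A"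
      by (simp only: mem_Collect_eq Int_iff rangeI)
    then have "f (?q z) \<in> f ` (range ?q \<inter> A)"
      by (rule imageI)
    then show "z \<in> f ` (range ?q \<inter> A)"
      unfolding f .
  qed
  have "f ` (range ?q \<inter> graph_line R F) = {z. Im z = 0}" "f ` (range ?q \<inter> graph_line R G) = {z. Re z = 0}"
    unfolding image in_F in_G by (rule refl)+
  moreover have q0: "?q 0 = rp2_of (disk_point R 1 (Complex x y))"
    by (simp add: S_def h_def squash_def)
  moreover have "f (rp2_of (disk_point R 1 (Complex x y))) = 0"
    using f q0 by metis
  moreover have "rp2_of (disk_point R 1 (Complex x y)) \<in> range ?q"
    using q0 by (metis rangeI)
  ultimately show ?thesis
    unfolding cross_transversally_at_def using opn hom by blast
qed

text \<open>Two graphs cross transversally where they are straight lines of distinct slopes; piecewise linear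
  functions are of this form near every common value off their break points.\<close>

definition transversal_profiles :: "(real \<Rightarrow> real \<Rightarrow> real) \<Rightarrow> (real \<Rightarrow> real \<Rightarrow> real) \<Rightarrow> bool" where
  "transversal_profiles F G \<longleftrightarrow>
     F 0 1 \<noteq> G 0 1 \<and> finite {x. F 1 x = G 1 x} \<and>
     (\<forall>x. F 1 x = G 1 x \<longrightarrow> (\<exists>\<delta>>0. \<exists>a b. a \<noteq> b \<and>
        (\<forall>x'. \<bar>x' - x\<bar> < \<delta> \<longrightarrow> F 1 x' = F 1 x + a * (x' - x) \<and> G 1 x' = F 1 x + b * (x' - x))))"

lemma graph_line_cases:
  assumes F: "projective_profile F" and p: "p \<in> graph_line R F"
  obtains "p = rp2_of (end_point (F 0 1))" | x where "p = rp2_of (disk_point R 1 (Complex x (F 1 x)))"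
proof -
  obtain t where t: "t \<in> {0..1}" "p = rp2_of (graph_path R F t)"
    using p by (auto simp: graph_line_def path_image_def)
  have "rp2_of (- end_point (F 0 1)) = rp2_of (end_point (F 0 1))"
    by (simp add: rp2_of_eq_iff)
  moreover have "t = 0 \<or> t = 1 \<or> 0 < t \<and> t < 1"
    using t(1) by auto
  ultimately show ?thesis
    using that t(2) graph_path_0 [OF F] graph_path_1 graph_path_interior [OF F] by metis
qed

text \<open>Distinct slopes give distinct points at infinity, so all common points are affine.\<close>

lemma graph_lines_meet:
  assumes R: "0 < R" and F: "projective_profile F" and G: "projective_profile G" and slopes: "F 0 1 \<noteq> G 0 1"
    and p: "p \<in> graph_line R F" "p \<in> graph_line R G"
  obtains x where "p = rp2_of (disk_point R 1 (Complex x (F 1 x)))" "F 1 x = G 1 x"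
  using F p(1)
proof (cases rule: graph_line_cases)
  case 1
  then have "p \<in> line_at_infinity"
    by (simp add: line_at_infinity_def)
  then have "p = rp2_of (end_point (G 0 1))"
    using graph_line_at_infinity [OF R G] p(2) by blast
  then show ?thesis
    using 1 slopes by (simp add: rp2_of_end_point_eq_iff)
next
  case (2 x)
  then show ?thesis
    using that p(2) affine_point_in_graph_line_iff [OF R G] by simp
qed

section \<open>Families of pairwise transversal graphs\<close>

lemma sin_eq_mult_cos_iff:
  "sin t = m * cos t \<longleftrightarrow> sin (t - arctan m) = 0"
proof -
  have "sin (arctan m) = m * cos (arctan m)"
    using tan_arctan [of m] cos_arctan_not_zero [of m] by (simp add: tan_def field_simps)
  then have "sin (t - arctan m) = cos (arctan m) * (sin t - m * cos t)"
    by (simp add: sin_diff algebra_simps)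
  then show ?thesis
    by simp
qed

context
  fixes R :: real and I :: "'i set" and F :: "'i \<Rightarrow> real \<Rightarrow> real \<Rightarrow> real"
  assumes R: "0 < R"
    and profile: "\<And>i. i \<in> I \<Longrightarrow> projective_profile (F i)"
    and transversal: "\<And>i j. i \<in> I \<Longrightarrow> j \<in> I \<Longrightarrow> i \<noteq> j \<Longrightarrow> transversal_profiles (F i) (F j)"
begin

lemma inj_on_graph_line: "inj_on (\<lambda>i. graph_line R (F i)) I"
proof (rule inj_onI, rule ccontr)
  fix i j assume ij: "i \<in> I" "j \<in> I" "i \<noteq> j" and "graph_line R (F i) = graph_line R (F j)"
  then have "rp2_of (end_point (F i 0 1)) = rp2_of (end_point (F j 0 1))"
    using graph_line_at_infinity [OF R profile] by (metis singleton_inject)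
  then show False
    using transversal [OF ij] by (simp add: rp2_of_end_point_eq_iff transversal_profiles_def)
qed

lemma quasiline_arrangement_graph_lines:
  assumes "finite I" "2 \<le> card I"
  shows "quasiline_arrangement ((\<lambda>i. graph_line R (F i)) ` I)"
proof -
  have pair: "finite (graph_line R (F i) \<inter> graph_line R (F j)) \<and>
      (\<forall>p \<in> graph_line R (F i) \<inter> graph_line R (F j).
         p \<notin> line_at_infinity \<and> cross_transversally_at (graph_line R (F i)) (graph_line R (F j)) p)"
    if ij: "i \<in> I" "j \<in> I" "i \<noteq> j" for i j
  proof -
    note transversal = transversal [OF ij, unfolded transversal_profiles_def]
    note meet = graph_lines_meet [OF R profile [OF ij(1)] profile [OF ij(2)]]
    have "graph_line R (F i) \<inter> graph_line R (F j)
        \<subseteq> (\<lambda>x. rp2_of (disk_point R 1 (Complex x (F i 1 x)))) ` {x. F i 1 x = F j 1 x}"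
      using meet transversal by blast
    then have "finite (graph_line R (F i) \<inter> graph_line R (F j))"
      using transversal by (meson finite_imageI finite_subset)
    moreover have "p \<notin> line_at_infinity" and
      "cross_transversally_at (graph_line R (F i)) (graph_line R (F j)) p"
      if p: "p \<in> graph_line R (F i)" "p \<in> graph_line R (F j)" for p
    proof -
      obtain x where x: "p = rp2_of (disk_point R 1 (Complex x (F i 1 x)))" "F i 1 x = F j 1 x"
        using meet p transversal by blast
      show "p \<notin> line_at_infinity"
      proof
        assume "p \<in> line_at_infinity"
        then obtain z where z: "norm z = 1" "p = rp2_of z"
          by (auto simp: line_at_infinity_def)
        then show False
          using x(1) norm_disk_point_less [OF R, of "Complex x (F i 1 x)"] by (auto simp: rp2_of_eq_iff)
      qed
      obtain \<delta> a b where "0 < \<delta>" "a \<noteq> b"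
        "\<And>x'. \<bar>x' - x\<bar> < \<delta> \<Longrightarrow> F i 1 x' = F i 1 x + a * (x' - x)"
        "\<And>x'. \<bar>x' - x\<bar> < \<delta> \<Longrightarrow> F j 1 x' = F i 1 x + b * (x' - x)"
        using transversal x(2) by blast
      then show "cross_transversally_at (graph_line R (F i)) (graph_line R (F j)) p"
        unfolding x(1) by (intro cross_transversally_graph_lines R profile ij)
    qed
    ultimately show ?thesis
      by blast
  qed
  have "\<exists>!p. p \<in> graph_line R (F i) \<inter> line_at_infinity" if "i \<in> I" for i
    using graph_line_at_infinity [OF R profile [OF that]] by simp
  moreover have "pseudoline (graph_line R (F i))" if "i \<in> I" for i
    using pseudoline_graph_line [OF R profile [OF that]] .
  ultimately show ?thesis
    unfolding quasiline_arrangement_def crossings_def ball_simps(9)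
  proof (intro conjI ballI impI)
    fix i j assume "i \<in> I" "j \<in> I" "graph_line R (F i) \<noteq> graph_line R (F j)"
    then show "finite (graph_line R (F i) \<inter> graph_line R (F j))"
      "\<And>p. p \<in> graph_line R (F i) \<inter> graph_line R (F j) \<Longrightarrow>
         cross_transversally_at (graph_line R (F i)) (graph_line R (F j)) p"
      using pair [of i j] by blast+
  next
    show "{p. \<exists>L\<in>(\<lambda>i. graph_line R (F i)) ` I. \<exists>M\<in>(\<lambda>i. graph_line R (F i)) ` I.
        L \<noteq> M \<and> p \<in> L \<and> p \<in> M} \<inter> line_at_infinity = {}"
      using pair by blast
  qed (use assms card_image [OF inj_on_graph_line] in auto)
qed

lemma monotone_graph_lines: "monotone_arrangement ((\<lambda>i. graph_line R (F i)) ` I)"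
  unfolding monotone_arrangement_def
proof (intro exI conjI)
  have "rp2_of \<i> \<notin> graph_line R (F i)" if "i \<in> I" for i
  proof
    assume "rp2_of \<i> \<in> graph_line R (F i)"
    moreover have "rp2_of \<i> \<in> line_at_infinity"
      by (simp add: line_at_infinity_def)
    ultimately have "rp2_of \<i> = rp2_of (end_point (F i 0 1))"
      using graph_line_at_infinity [OF R profile [OF that]] by blast
    then show False
      using Re_end_point [of "F i 0 1"] by (auto simp: rp2_of_eq_iff)
  qed
  then show "marking ((\<lambda>i. graph_line R (F i)) ` I) 1 \<i>"
    by (auto simp: marking_def)
  define \<gamma> where "\<gamma> L = graph_path R (F (inv_into I (\<lambda>i. graph_line R (F i)) L))" for L
  have \<gamma>: "\<gamma> (graph_line R (F i)) = graph_path R (F i)" if "i \<in> I" for i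
    using inv_into_f_f [OF inj_on_graph_line that] by (simp add: \<gamma>_def)
  have same_time: "s = s'" if "i \<in> I" "j \<in> I" "i \<noteq> j" "s \<in> {0..1}" "s' \<in> {0..1}"
    "rp2_of (graph_path R (F i) s) = rp2_of (graph_path R (F j) s')" for i j s s'
    using graph_path_meet [OF R profile [OF that(1)] profile [OF that(2)] that(4-6)] transversal [OF that(1-3)]
    by (auto simp: transversal_profiles_def)
  show "proper_marked ((\<lambda>i. graph_line R (F i)) ` I) 1 \<i>"
    unfolding proper_marked_def ball_simps(9)
  proof (intro exI [of _ \<gamma>] conjI ballI impI)
    fix i assume "i \<in> I"
    then show "traversal 1 \<i> (graph_line R (F i)) (\<gamma> (graph_line R (F i)))"
      unfolding \<gamma> [OF \<open>i \<in> I\<close>] by (intro traversal_graph_path R profile)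
  next
    fix i j s t s' t'
    assume ij: "i \<in> I" "j \<in> I" "graph_line R (F i) \<noteq> graph_line R (F j)"
      and times: "s \<in> {0..1}" "t \<in> {0..1}" "s' \<in> {0..1}" "t' \<in> {0..1}"
      and meet: "rp2_of (\<gamma> (graph_line R (F i)) s) = rp2_of (\<gamma> (graph_line R (F j)) s') \<and>
        rp2_of (\<gamma> (graph_line R (F i)) t) = rp2_of (\<gamma> (graph_line R (F j)) t')"
    have "i \<noteq> j"
      using ij(3) by blast
    then have "s = s'" "t = t'"
      using same_time [OF ij(1,2)] times meet by (auto simp: \<gamma> ij(1,2))
    then show "s < t \<longleftrightarrow> s' < t'"
      by simp
  qed
qed

text \<open>Near the centre the \<open>k\<close>-th curve is the straight line of slope \<open>m k\<close>, which a small circle meets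
  in the directions \<open>arctan (m k)\<close> and \<open>arctan (m k) + pi\<close>.  Since all arc tangents lie in an
  interval of length \<open>pi\<close>, the second intersections follow after all the first ones, in the same
  order.\<close>

lemma appear_around_graph_lines:
  assumes c: "\<bar>c\<bar> < R" and \<delta>: "0 < \<delta>"
    and "distinct xs" "set xs = {i \<in> I. F i 1 c = 0}"
    and m: "strict_mono_on {..<length xs} m"
    and affine: "\<And>k x. k < length xs \<Longrightarrow> \<bar>x - c\<bar> < \<delta> \<Longrightarrow> F (xs ! k) 1 x = m k * (x - c)"
  shows "appear_around ((\<lambda>i. graph_line R (F i)) ` I) (rp2_of (disk_point R 1 (of_real c)))
           (map (\<lambda>i. graph_line R (F i)) xs)"
proof -
  let ?g = "\<lambda>i. graph_line R (F i)" and ?r = "length xs" and ?c = "disk_point R 1 (of_real c)"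
  define \<theta> where "\<theta> k = (if k < ?r then arctan (m k) else arctan (m (k - ?r)) + pi)" for k
  have bounds: "- (pi / 2) < arctan a" "arctan a < pi / 2" for a
    by (rule arctan_lbound arctan_ubound)+
  have mono: "strict_mono_on {..<2 * ?r} \<theta>"
  proof (rule strict_mono_onI)
    fix j k assume jk: "j \<in> {..<2 * ?r}" "k \<in> {..<2 * ?r}" "j < k"
    consider "k < ?r" | "j < ?r" "?r \<le> k" | "?r \<le> j"
      by linarith
    then show "\<theta> j < \<theta> k"
    proof cases
      case 1
      then show ?thesis
        using jk m by (simp add: \<theta>_def strict_mono_on_def arctan_less_iff)
    next
      case 2
      then show ?thesis
        using bounds [of "m j"] bounds [of "m (k - ?r)"] by (simp add: \<theta>_def)
    next
      case 3
      then show ?thesis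
        using jk strict_mono_onD [OF m, of "j - ?r" "k - ?r"] by (simp add: \<theta>_def arctan_less_iff)
    qed
  qed
  have angles: "{t \<in> {\<theta> 0..<\<theta> 0 + 2 * pi}. rp2_of (?c + of_real \<epsilon> * cis t) \<in> map ?g xs ! k} = {\<theta> k, \<theta> (k + ?r)}"
    if \<epsilon>: "0 < \<epsilon>" "2 * R * \<epsilon> < \<delta>" "\<bar>c\<bar> + 2 * R * \<epsilon> \<le> R" and k: "k < ?r" for \<epsilon> k
  proof -
    have k_in: "xs ! k \<in> I"
      using k assms(4) nth_mem by blast
    \<comment> \<open>Near the centre the disk is the plane shrunk by the factor \<open>2 * R\<close>, so the circle of radius
      \<open>\<epsilon>\<close> in the disk is the circle of radius \<open>2 * R * \<epsilon>\<close> in the plane.\<close>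
    have on_line: "rp2_of (?c + of_real \<epsilon> * cis t) \<in> ?g (xs ! k) \<longleftrightarrow> sin (t - arctan (m k)) = 0" for t
    proof -
      let ?z = "of_real c + of_real (2 * R * \<epsilon>) * cis t"
      have "norm ?z \<le> \<bar>c\<bar> + 2 * R * \<epsilon>"
        using R \<epsilon> norm_triangle_ineq [of "of_real c" "of_real (2 * R * \<epsilon>) * cis t"]
        by (simp add: norm_mult)
      then have "?c + of_real \<epsilon> * cis t = disk_point R 1 ?z"
        using c R \<epsilon> by (subst (1 2) disk_point_central) (auto simp: complex_eq_iff field_simps)
      then have "rp2_of (?c + of_real \<epsilon> * cis t) \<in> ?g (xs ! k) \<longleftrightarrow>
          2 * R * \<epsilon> * sin t = F (xs ! k) 1 (c + 2 * R * \<epsilon> * cos t)"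
        using affine_point_in_graph_line_iff [OF R profile [OF k_in], of ?z] by simp
      also have "F (xs ! k) 1 (c + 2 * R * \<epsilon> * cos t) = m k * (2 * R * \<epsilon> * cos t)"
      proof -
        have "\<bar>2 * R * \<epsilon> * cos t\<bar> \<le> 2 * R * \<epsilon> * 1"
          unfolding abs_mult using R \<epsilon> by (intro mult_mono) auto
        then show ?thesis
          using affine [OF k, of "c + 2 * R * \<epsilon> * cos t"] \<epsilon> by simp
      qed
      also have "2 * R * \<epsilon> * sin t = m k * (2 * R * \<epsilon> * cos t) \<longleftrightarrow> sin t = m k * cos t"
        using R \<epsilon> by (auto simp: algebra_simps)
      finally show ?thesis
        by (simp only: sin_eq_mult_cos_iff)
    qed
    have \<theta>k: "\<theta> 0 \<le> \<theta> k" "\<theta> k < \<theta> 0 + pi"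
      using mono k bounds [of "m 0"] bounds [of "m k"] strict_mono_on_leD [OF mono, of 0 k]
      by (auto simp: \<theta>_def)
    have \<theta>_eq: "\<theta> k = arctan (m k)" "\<theta> (k + ?r) = \<theta> k + pi"
      using k by (simp_all add: \<theta>_def)
    have zeros: "t = \<theta> k \<or> t = \<theta> k + pi" if t: "\<theta> 0 \<le> t" "t < \<theta> 0 + 2 * pi" "sin (t - \<theta> k) = 0" for t
    proof -
      obtain n :: int where n: "t - \<theta> k = of_int n * pi"
        using t(3) by (auto simp: sin_zero_iff_int2)
      have "- 1 * pi < of_int n * pi" "of_int n * pi < 2 * pi"
        using n t \<theta>k by linarith+
      then have "- 1 < real_of_int n" "real_of_int n < 2"
        by (simp_all only: mult_less_cancel_right_pos [OF pi_gt_zero])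
      then have "n = 0 \<or> n = 1"
        by linarith
      then show ?thesis
        using n by auto
    qed
    have "rp2_of (?c + of_real \<epsilon> * cis t) \<in> map ?g xs ! k \<longleftrightarrow> sin (t - \<theta> k) = 0" for t
      using k on_line by (simp add: \<theta>_eq)
    then show ?thesis
      unfolding \<theta>_eq(2) using zeros \<theta>k pi_gt_zero by auto
  qed
  have "eventually (\<lambda>\<epsilon>. 0 < \<epsilon> \<and> 2 * R * \<epsilon> < \<delta> \<and> \<bar>c\<bar> + 2 * R * \<epsilon> \<le> R) (at_right 0)"
  proof -
    have "eventually (\<lambda>\<epsilon>. \<epsilon> < min (\<delta> / (2 * R)) ((R - \<bar>c\<bar>) / (2 * R))) (at_right 0)"
      using R \<delta> c by (intro eventually_at_rightI [of 0 "min (\<delta> / (2 * R)) ((R - \<bar>c\<bar>) / (2 * R))"]) auto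
    moreover have "eventually (\<lambda>\<epsilon>::real. 0 < \<epsilon>) (at_right 0)"
      by (rule eventually_at_right_less)
    ultimately show ?thesis
      by eventually_elim (use R in \<open>auto simp: field_simps\<close>)
  qed
  then have "\<forall>\<^sub>F \<epsilon> in at_right 0. \<exists>\<theta> :: nat \<Rightarrow> real. strict_mono_on {..<2 * ?r} \<theta> \<and>
      (\<forall>k<?r. {t \<in> {\<theta> 0..<\<theta> 0 + 2 * pi}. rp2_of (?c + of_real \<epsilon> * cis t) \<in> map ?g xs ! k} =
        {\<theta> k, \<theta> (k + ?r)})"
    by eventually_elim (use mono angles in blast)
  moreover have "distinct (map ?g xs)"
    using assms(3,4) inj_on_graph_line by (auto simp: distinct_map intro: inj_on_subset)
  moreover have "set (map ?g xs) = {L \<in> ?g ` I. rp2_of ?c \<in> L}"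
    using assms(4) affine_point_in_graph_line_iff [OF R profile, of _ "of_real c"] by auto
  moreover have "norm ?c < 1"
    using R by (rule norm_disk_point_less)
  ultimately show ?thesis
    unfolding appear_around_def by auto
qed

end

section \<open>Piecewise linear profiles with prescribed heights\<close>

text \<open>The piecewise linear function with height \<open>v k\<close> at the integers \<open>k\<close> up to \<open>N\<close> and height \<open>s * n\<close> at
  all other integers \<open>n\<close>, written as its asymptote plus a finite combination of tent functions.  In
  this form the homogenization is continuous without a case distinction at infinity.\<close>

definition tent_profile :: "real \<Rightarrow> (nat \<Rightarrow> real) \<Rightarrow> nat \<Rightarrow> real \<Rightarrow> real \<Rightarrow> real" where
  "tent_profile s v N w u = s * u + (\<Sum>k\<le>N. (v k - s * k) * max 0 (w - \<bar>u - k * w\<bar>))"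

lemma tent_profile_infinity: "tent_profile s v N 0 u = s * u"
  by (simp add: tent_profile_def)

lemma projective_profile_tent_profile: "projective_profile (tent_profile s v N)"
  unfolding projective_profile_def
proof (intro conjI allI impI)
  show "continuous_on UNIV (\<lambda>(w, u). tent_profile s v N w u)"
    unfolding tent_profile_def case_prod_unfold by (intro continuous_intros)
next
  fix c w u :: real assume c: "0 \<le> c"
  have "max 0 (c * w - \<bar>c * u - k * (c * w)\<bar>) = c * max 0 (w - \<bar>u - k * w\<bar>)" for k :: real
  proof -
    have "\<bar>c * u - k * (c * w)\<bar> = \<bar>c * (u - k * w)\<bar>"
      by (simp add: algebra_simps)
    also have "\<dots> = c * \<bar>u - k * w\<bar>"
      using c by (simp add: abs_mult)
    finally show ?thesis
      using c by (simp add: max_mult_distrib_left right_diff_distrib)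
  qed
  then show "tent_profile s v N (c * w) (c * u) = c * tent_profile s v N w u"
    unfolding tent_profile_def by (simp only: sum_distrib_left distrib_left mult.left_commute [of c])
qed (simp add: tent_profile_infinity)

lemma tent_profile_grid:
  fixes n :: int
  shows "tent_profile s v N 1 n = (if 0 \<le> n \<and> n \<le> int N then v (nat n) else s * n)"
proof -
  have "max 0 (1 - \<bar>real_of_int n - real k * 1\<bar>) = (if int k = n then 1 else 0)" for k
  proof (cases "int k = n")
    case False
    then have "1 \<le> \<bar>n - int k\<bar>"
      by linarith
    then have "1 \<le> \<bar>real_of_int n - real k\<bar>"
      by linarith
    then show ?thesis
      using False by simp
  qed auto
  then have "tent_profile s v N 1 n = s * n + (\<Sum>k\<le>N. if int k = n then v k - s * k else 0)"
    unfolding tent_profile_def by (simp only: if_distrib [of "(*) _"] mult_1_right mult_zero_right)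
  also have "(\<Sum>k\<le>N. if int k = n then v k - s * k else 0) =
      (if 0 \<le> n \<and> n \<le> int N then v (nat n) - s * n else 0)"
  proof (cases "0 \<le> n")
    case True
    then have "int k = n \<longleftrightarrow> nat n = k" for k
      by auto
    then show ?thesis
      using True by (simp add: nat_le_iff)
  qed (auto intro!: sum.neutral)
  finally show ?thesis
    by simp
qed

lemma tent_profile_affine:
  fixes n :: int and x :: real
  assumes "n \<le> x" "x \<le> n + 1"
  shows "tent_profile s v N 1 x = tent_profile s v N 1 n
           + (x - n) * (tent_profile s v N 1 (n + 1) - tent_profile s v N 1 n)"
proof -
  let ?h = "\<lambda>k x. max 0 (1 - \<bar>x - real k * 1\<bar>)"
  have tent: "?h k x = (1 - (x - n)) * ?h k n + (x - n) * ?h k (n + 1)" for k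
  proof -
    have "int k \<le> n - 1 \<or> int k = n \<or> int k = n + 1 \<or> int k \<ge> n + 2"
      by linarith
    then consider "real k \<le> n - 1" | "real k = n" | "real k = n + 1" | "real k \<ge> n + 2"
      by linarith
    then show ?thesis
    proof cases
      case 1
      then have "1 - \<bar>x - real k * 1\<bar> \<le> 0" "1 - \<bar>n - real k * 1\<bar> \<le> 0" "1 - \<bar>n + 1 - real k * 1\<bar> \<le> 0"
        using assms by auto
      then show ?thesis
        by (simp add: max_absorb1)
    next
      case 4
      then have "1 - \<bar>x - real k * 1\<bar> \<le> 0" "1 - \<bar>n - real k * 1\<bar> \<le> 0" "1 - \<bar>n + 1 - real k * 1\<bar> \<le> 0"
        using assms by auto
      then show ?thesis
        by (simp add: max_absorb1)
    qed (use assms in \<open>auto simp: max_def\<close>)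
  qed
  have "tent_profile s v N 1 x = s * ((1 - (x - n)) * n + (x - n) * (n + 1))
      + (\<Sum>k\<le>N. (v k - s * k) * ((1 - (x - n)) * ?h k n + (x - n) * ?h k (n + 1)))"
    unfolding tent_profile_def tent [symmetric] by (simp add: algebra_simps)
  also have "\<dots> = (1 - (x - n)) * tent_profile s v N 1 n + (x - n) * tent_profile s v N 1 (n + 1)"
    unfolding tent_profile_def sum_distrib_left distrib_left
    by (simp add: sum.distrib ac_simps)
  finally show ?thesis
    by (simp add: algebra_simps)
qed

text \<open>Outside \<open>{0..N}\<close> the heights at an integer \<open>n\<close> are \<open>s * n\<close> and \<open>s' * n\<close>, hence also distinct, because
  \<open>0\<close> belongs to the prescribed range.  So the two functions differ at every integer, and inside a
  unit cell both are affine; a common zero of their difference therefore has a slope different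
  from zero and is the only one in its cell.  Far out both functions are their asymptotes.\<close>

lemma transversal_tent_profiles:
  assumes s: "s \<noteq> s'" and v: "\<And>k. k \<le> N \<Longrightarrow> v k \<noteq> v' k"
  shows "transversal_profiles (tent_profile s v N) (tent_profile s' v' N)"
proof -
  let ?F = "tent_profile s v N 1" and ?G = "tent_profile s' v' N 1"
  have grid: "?F (of_int n) \<noteq> ?G (of_int n)" for n
  proof (cases "0 \<le> n \<and> n \<le> int N")
    case True
    then show ?thesis
      unfolding tent_profile_grid using v [of "nat n"] by (simp add: nat_le_iff)
  next
    case False
    then show ?thesis
      unfolding tent_profile_grid using s by auto
  qed
  have affine:
    "?F y = ?F \<lfloor>x\<rfloor> + (y - \<lfloor>x\<rfloor>) * (?F (\<lfloor>x\<rfloor> + 1) - ?F \<lfloor>x\<rfloor>)"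
    "?G y = ?G \<lfloor>x\<rfloor> + (y - \<lfloor>x\<rfloor>) * (?G (\<lfloor>x\<rfloor> + 1) - ?G \<lfloor>x\<rfloor>)"
    if "\<lfloor>x\<rfloor> \<le> y" "y \<le> \<lfloor>x\<rfloor> + 1" for x y :: real
    using that by (intro tent_profile_affine; simp)+
  have local_form: "\<lfloor>x\<rfloor> < x \<and> x < \<lfloor>x\<rfloor> + 1 \<and> ?F (\<lfloor>x\<rfloor> + 1) - ?F \<lfloor>x\<rfloor> \<noteq> ?G (\<lfloor>x\<rfloor> + 1) - ?G \<lfloor>x\<rfloor>"
    if x: "?F x = ?G x" for x :: real
  proof -
    have "x \<noteq> \<lfloor>x\<rfloor>"
      using grid x by metis
    then have "\<lfloor>x\<rfloor> < x" "x < \<lfloor>x\<rfloor> + 1"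
      by linarith+
    moreover have "?F (\<lfloor>x\<rfloor> + 1) - ?F \<lfloor>x\<rfloor> \<noteq> ?G (\<lfloor>x\<rfloor> + 1) - ?G \<lfloor>x\<rfloor>"
    proof
      assume "?F (\<lfloor>x\<rfloor> + 1) - ?F \<lfloor>x\<rfloor> = ?G (\<lfloor>x\<rfloor> + 1) - ?G \<lfloor>x\<rfloor>"
      then have "(x - \<lfloor>x\<rfloor>) * (?F (\<lfloor>x\<rfloor> + 1) - ?F \<lfloor>x\<rfloor>) = (x - \<lfloor>x\<rfloor>) * (?G (\<lfloor>x\<rfloor> + 1) - ?G \<lfloor>x\<rfloor>)"
        by (rule arg_cong)
      then have "?F \<lfloor>x\<rfloor> = ?G \<lfloor>x\<rfloor>"
        using x affine [of x x] \<open>\<lfloor>x\<rfloor> < x\<close> \<open>x < \<lfloor>x\<rfloor> + 1\<close> by linarith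
      then show False
        using grid [of "\<lfloor>x\<rfloor>"] by contradiction
    qed
    ultimately show ?thesis
      by blast
  qed
  have "finite {x :: real. ?F x = ?G x}"
  proof (rule inj_on_finite)
    show "inj_on floor {x :: real. ?F x = ?G x}"
    proof (rule inj_onI)
      fix x y assume "x \<in> {x :: real. ?F x = ?G x}" "y \<in> {x :: real. ?F x = ?G x}" and n: "\<lfloor>x\<rfloor> = \<lfloor>y\<rfloor>"
      then have xy: "?F x = ?G x" "?F y = ?G y"
        by auto
      define a b where "a = ?F (\<lfloor>x\<rfloor> + 1) - ?F \<lfloor>x\<rfloor>" and "b = ?G (\<lfloor>x\<rfloor> + 1) - ?G \<lfloor>x\<rfloor>"
      have line: "?F z = ?F \<lfloor>x\<rfloor> + (z - \<lfloor>x\<rfloor>) * a" "?G z = ?G \<lfloor>x\<rfloor> + (z - \<lfloor>x\<rfloor>) * b" if "z \<in> {x, y}" for z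
      proof -
        have "\<lfloor>x\<rfloor> \<le> z" "z \<le> \<lfloor>x\<rfloor> + 1"
          using that local_form [OF xy(1)] local_form [OF xy(2)] n by auto
        then show "?F z = ?F \<lfloor>x\<rfloor> + (z - \<lfloor>x\<rfloor>) * a" "?G z = ?G \<lfloor>x\<rfloor> + (z - \<lfloor>x\<rfloor>) * b"
          unfolding a_def b_def by (rule affine)+
      qed
      have "?F y - ?F x = (y - x) * a" "?G y - ?G x = (y - x) * b"
        using line [of x] line [of y] by (simp_all add: algebra_simps)
      then have "(y - x) * a = (y - x) * b"
        using xy by linarith
      then show "x = y"
        using local_form [OF xy(1)] unfolding a_def [symmetric] b_def [symmetric] by simp
    qed
    show "floor ` {x :: real. ?F x = ?G x} \<subseteq> {- 1..int N}"
    proof clarify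
      fix x assume x: "?F x = ?G x"
      have far: "tent_profile s v N 1 x = s * x" if "x < - 1 \<or> real N + 1 \<le> x" for s v
      proof -
        have "max 0 (1 - \<bar>x - real k * 1\<bar>) = 0" if "k \<le> N" for k
          using that \<open>x < - 1 \<or> _\<close> by (auto simp: max_def)
        then show ?thesis
          by (simp add: tent_profile_def)
      qed
      have "\<not> (x < - 1 \<or> real N + 1 \<le> x)"
        using far [of s v] far [of s' v'] x s by auto
      then show "\<lfloor>x\<rfloor> \<in> {- 1..int N}"
        by (auto simp: le_floor_iff floor_le_iff)
    qed
  qed simp
  moreover have "\<exists>\<delta>>0. \<exists>a b. a \<noteq> b \<and> (\<forall>x'. \<bar>x' - x\<bar> < \<delta> \<longrightarrow>
      ?F x' = ?F x + a * (x' - x) \<and> ?G x' = ?F x + b * (x' - x))" if x: "?F x = ?G x" for x :: real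
  proof -
    define a b where "a = ?F (\<lfloor>x\<rfloor> + 1) - ?F \<lfloor>x\<rfloor>" and "b = ?G (\<lfloor>x\<rfloor> + 1) - ?G \<lfloor>x\<rfloor>"
    define \<delta> where "\<delta> = min (x - \<lfloor>x\<rfloor>) (\<lfloor>x\<rfloor> + 1 - x)"
    have cell: "\<lfloor>x\<rfloor> < x" "x < \<lfloor>x\<rfloor> + 1" and "a \<noteq> b"
      using local_form [OF x] by (auto simp: a_def b_def)
    have "?F x' = ?F x + a * (x' - x) \<and> ?G x' = ?F x + b * (x' - x)" if "\<bar>x' - x\<bar> < \<delta>" for x'
    proof -
      have "\<lfloor>x\<rfloor> \<le> x'" "x' \<le> \<lfloor>x\<rfloor> + 1"
        using that unfolding \<delta>_def by linarith+
      then have "?F x' = ?F \<lfloor>x\<rfloor> + (x' - \<lfloor>x\<rfloor>) * a" "?G x' = ?G \<lfloor>x\<rfloor> + (x' - \<lfloor>x\<rfloor>) * b"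
        unfolding a_def b_def by (rule affine)+
      moreover have "?F x = ?F \<lfloor>x\<rfloor> + (x - \<lfloor>x\<rfloor>) * a" "?G x = ?G \<lfloor>x\<rfloor> + (x - \<lfloor>x\<rfloor>) * b"
        unfolding a_def b_def using less_imp_le [OF cell(1)] less_imp_le [OF cell(2)] by (rule affine)+
      ultimately show ?thesis
        unfolding x by (simp add: algebra_simps)
    qed
    moreover have "0 < \<delta>"
      using cell by (simp add: \<delta>_def)
    ultimately show ?thesis
      using \<open>a \<noteq> b\<close> by blast
  qed
  ultimately show ?thesis
    using s by (simp add: transversal_profiles_def tent_profile_infinity)
qed

section \<open>The realization\<close>

lemma realization_with_prescribed_orders:
  fixes C :: "('p, 'l) incidence"
  assumes C: "incidence_structure C"
    and ord: "\<And>p. p \<in> points C \<Longrightarrow> distinct (ord p) \<and> set (ord p) = {l. (p, l) \<in> inc C}"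
  shows "\<exists>D f g. monotone_quasi_topological D \<and> incidence_isomorphism f g C D \<and>
           (\<forall>p\<in>points C. appear_around (lines D) (f p) (map g (ord p)))"
proof -
  have finite: "finite (points C)" "finite (lines C)" and nonempty: "points C \<noteq> {}" "lines C \<noteq> {}"
    and inc: "inc C \<subseteq> points C \<times> lines C"
    and card_lines: "\<And>p. p \<in> points C \<Longrightarrow> 2 \<le> card {l. (p, l) \<in> inc C}"
    and card_points: "\<And>l. l \<in> lines C \<Longrightarrow> 2 \<le> card {p. (p, l) \<in> inc C}"
    using C by (auto simp: incidence_structure_def)
  define m n where "m = card (points C)" and "n = card (lines C)"
  obtain num where num: "bij_betw num (points C) {0..<m}"
    using ex_bij_betw_finite_nat [OF finite(1)] by (auto simp: m_def)
  obtain idx where idx: "bij_betw idx (lines C) {0..<n}"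
    using ex_bij_betw_finite_nat [OF finite(2)] by (auto simp: n_def)
  define pnt where "pnt = inv_into (points C) num"
  have pnt_num: "pnt (num p) = p" if "p \<in> points C" for p
    unfolding pnt_def using bij_betw_inv_into_left [OF num that] .
  have num_less: "num p < m" if "p \<in> points C" for p
    using bij_betwE [OF num] that by auto
  have idx_eq: "idx l = idx l' \<longleftrightarrow> l = l'" if "l \<in> lines C" "l' \<in> lines C" for l l'
    using idx that by (auto simp: bij_betw_def dest: inj_onD)
  define rank where "rank p = inv_into {..<length (ord p)} ((!) (ord p))" for p
  have rank_nth: "rank p (ord p ! k) = k" if "p \<in> points C" "k < length (ord p)" for p k
    unfolding rank_def using that ord by (intro inv_into_f_f inj_on_nth) auto
  have nth_rank: "ord p ! rank p l = l \<and> rank p l < length (ord p)" if "(p, l) \<in> inc C" for p l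
  proof -
    have "l \<in> set (ord p)"
      using that inc ord by blast
    then show ?thesis
      using rank_nth that inc by (metis SigmaE in_set_conv_nth prod.inject subsetD)
  qed
  have rank_less: "rank p l < n" if "(p, l) \<in> inc C" for p l
  proof -
    have "length (ord p) = card {l. (p, l) \<in> inc C}"
      using that inc ord by (metis SigmaE distinct_card prod.inject subsetD)
    also have "\<dots> \<le> n"
      unfolding n_def using inc finite(2) by (intro card_mono) auto
    finally show ?thesis
      using nth_rank [OF that] by linarith
  qed
  \<comment> \<open>The point number \<open>j\<close> owns the cell between \<open>2 * j + 1\<close> and \<open>2 * j + 2\<close>.  A line through it
    crosses this cell from minus its rank to plus its rank, counted from 1; a line that avoids it
    stays constant above all ranks.  The integer 0 belongs to no cell of a point.\<close>
  define height where "height l k =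
     (if k = 0 then real (idx l)
      else if (pnt ((k - 1) div 2), l) \<in> inc C
        then (if odd k then - 1 else 1) * (real (rank (pnt ((k - 1) div 2)) l) + 1)
        else real (n + 1 + idx l))" for l k
  have height_neq: "height l k \<noteq> height l' k" if l: "l \<in> lines C" "l' \<in> lines C" "l \<noteq> l'" for l l' k
  proof -
    let ?p = "pnt ((k - 1) div 2)"
    have "rank ?p l \<noteq> rank ?p l'" if "(?p, l) \<in> inc C" "(?p, l') \<in> inc C"
      using nth_rank that l(3) by metis
    then show ?thesis
      using idx_eq [OF l(1,2)] l(3) rank_less [of ?p l] rank_less [of ?p l']
      by (auto simp: height_def)
  qed
  define F where "F l = tent_profile (idx l) (height l) (2 * m)" for l
  have profile: "projective_profile (F l)" for l
    by (simp add: F_def projective_profile_tent_profile)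
  have transversal: "transversal_profiles (F l) (F l')" if "l \<in> lines C" "l' \<in> lines C" "l \<noteq> l'" for l l'
    unfolding F_def using that height_neq idx_eq by (intro transversal_tent_profiles) auto
  \<comment> \<open>The centre of the cell of \<open>p\<close>, and a radius within which the centres of all cells lie.\<close>
  define c where "c p = 2 * real (num p) + 3 / 2" for p
  define R where "R = 2 * real m + 2"
  have R: "0 < R"
    by (simp add: R_def)
  have c_bound: "\<bar>c p\<bar> < R" if "p \<in> points C" for p
    using num_less [OF that] by (simp add: c_def R_def)
  have F_near: "F l 1 x = (if (p, l) \<in> inc C then 2 * (real (rank p l) + 1) * (x - c p) else real (n + 1 + idx l))"
    if p: "p \<in> points C" and x: "\<bar>x - c p\<bar> \<le> 1 / 2" for p l x
  proof -
    let ?k = "2 * int (num p) + 1"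
    have grid: "F l 1 (of_int ?k) = height l (2 * num p + 1)" "F l 1 (of_int ?k + 1) = height l (2 * num p + 2)"
      using num_less [OF p] tent_profile_grid [of "idx l" "height l" "2 * m" ?k]
        tent_profile_grid [of "idx l" "height l" "2 * m" "?k + 1"]
      by (auto simp: F_def nat_add_distrib nat_mult_distrib)
    have "of_int ?k \<le> x" "x \<le> of_int ?k + 1"
      using x unfolding c_def abs_le_iff by (simp_all add: field_simps)
    then have F_line: "F l 1 x = F l 1 (of_int ?k) + (x - of_int ?k) * (F l 1 (of_int ?k + 1) - F l 1 (of_int ?k))"
      using tent_profile_affine [of ?k x] by (simp add: F_def)
    have heights: "height l (2 * num p + 1) = (if (p, l) \<in> inc C then - (real (rank p l) + 1) else real (n + 1 + idx l))"
      "height l (2 * num p + 2) = (if (p, l) \<in> inc C then real (rank p l) + 1 else real (n + 1 + idx l))"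
      by (simp_all add: height_def pnt_num [OF p])
    show ?thesis
      using F_line unfolding grid heights by (cases "(p, l) \<in> inc C") (simp_all add: c_def algebra_simps)
  qed
  define pt where "pt p = rp2_of (disk_point R 1 (of_real (c p)))" for p
  define g where "g l = graph_line R (F l)" for l
  have pt_in_iff: "pt p \<in> g l \<longleftrightarrow> (p, l) \<in> inc C" if "p \<in> points C" for p l
    using affine_point_in_graph_line_iff [OF R profile, of "of_real (c p)" l] F_near [OF that, of "c p" l]
    by (simp add: pt_def g_def)
  have inj_pt: "inj_on pt (points C)"
  proof (rule inj_onI)
    fix p p' assume "p \<in> points C" "p' \<in> points C" "pt p = pt p'"
    then show "p = p'"
      using rp2_of_disk_point_eq_iff [OF R] pnt_num by (simp add: pt_def c_def) metis
  qed
  have inj_g: "inj_on g (lines C)"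
    unfolding g_def using R profile transversal by (rule inj_on_graph_line)
  obtain p\<^sub>0 where "p\<^sub>0 \<in> points C"
    using nonempty by blast
  have "card {l. (p\<^sub>0, l) \<in> inc C} \<le> card (lines C)"
    using inc finite(2) by (intro card_mono) auto
  then have "2 \<le> card (lines C)"
    using card_lines [OF \<open>p\<^sub>0 \<in> points C\<close>] by linarith
  then have arrangement: "quasiline_arrangement (g ` lines C)"
    unfolding g_def using R profile transversal finite(2) by (intro quasiline_arrangement_graph_lines)
  define D where "D = \<lparr>points = pt ` points C, lines = g ` lines C,
    inc = {(P, L). P \<in> pt ` points C \<and> L \<in> g ` lines C \<and> P \<in> L}\<rparr>"
  have lines_at: "{L. (pt p, L) \<in> inc D} = g ` {l. (p, l) \<in> inc C}" if "p \<in> points C" for p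
    using that pt_in_iff [OF that] inc by (auto simp: D_def)
  have points_on: "{P. (P, g l) \<in> inc D} = pt ` {p. (p, l) \<in> inc C}" if "l \<in> lines C" for l
    using that pt_in_iff inc by (auto simp: D_def)
  have card_lines_D: "2 \<le> card {L. (pt p, L) \<in> inc D}" if "p \<in> points C" for p
  proof -
    have "inj_on g {l. (p, l) \<in> inc C}"
      using inj_g by (rule inj_on_subset) (use inc in auto)
    then show ?thesis
      unfolding lines_at [OF that] using card_lines [OF that] by (simp add: card_image)
  qed
  have card_points_D: "2 \<le> card {P. (P, g l) \<in> inc D}" if "l \<in> lines C" for l
  proof -
    have "inj_on pt {p. (p, l) \<in> inc C}"
      using inj_pt by (rule inj_on_subset) (use inc in auto)
    then show ?thesis
      unfolding points_on [OF that] using card_points [OF that] by (simp add: card_image)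
  qed
  have "incidence_structure D"
    unfolding incidence_structure_def
  proof (intro conjI ballI)
    fix P assume "P \<in> points D"
    then show "2 \<le> card {L. (P, L) \<in> inc D}"
      using card_lines_D by (auto simp: D_def)
  next
    fix L assume "L \<in> lines D"
    then show "2 \<le> card {P. (P, L) \<in> inc D}"
      using card_points_D by (auto simp: D_def)
  qed (use finite nonempty in \<open>auto simp: D_def\<close>)
  moreover have "points D \<subseteq> crossings (lines D)"
  proof
    fix P assume "P \<in> points D"
    then obtain p where p: "p \<in> points C" "P = pt p"
      by (auto simp: D_def)
    let ?S = "{L. (P, L) \<in> inc D}"
    have "2 \<le> card ?S"
      using card_lines_D [OF p(1)] p(2) by simp
    moreover from this have "finite ?S"
      by (intro card_ge_0_finite) linarith
    ultimately obtain L M where "L \<noteq> M" "(P, L) \<in> inc D" "(P, M) \<in> inc D"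
      using card_le_Suc0_iff_eq [of ?S] by auto
    then show "P \<in> crossings (lines D)"
      by (auto simp: D_def crossings_def)
  qed
  moreover have "monotone_arrangement (lines D)"
    unfolding D_def g_def using monotone_graph_lines [OF R profile transversal] by simp
  ultimately have "monotone_quasi_topological D"
    using arrangement by (simp add: monotone_quasi_topological_def quasi_topological_def D_def)
  moreover have "incidence_isomorphism pt g C D"
    using inj_pt inj_g pt_in_iff
    by (auto simp: incidence_isomorphism_def D_def bij_betw_def)
  moreover have "appear_around (lines D) (pt p) (map g (ord p))" if p: "p \<in> points C" for p
  proof -
    have "appear_around ((\<lambda>l. graph_line R (F l)) ` lines C) (rp2_of (disk_point R 1 (of_real (c p))))
        (map (\<lambda>l. graph_line R (F l)) (ord p))"
    proof (rule appear_around_graph_lines [OF R profile transversal c_bound [OF p]])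
      show "set (ord p) = {l \<in> lines C. F l 1 (c p) = 0}"
        using ord [OF p] inc F_near [OF p, of "c p"] by auto
      show "strict_mono_on {..<length (ord p)} (\<lambda>k. 2 * (real k + 1))"
        by (simp add: strict_mono_on_def)
      show "F (ord p ! k) 1 x = 2 * (real k + 1) * (x - c p)" if "k < length (ord p)" "\<bar>x - c p\<bar> < 1 / 2" for k x
      proof -
        have "(p, ord p ! k) \<in> inc C"
          using ord [OF p] that(1) nth_mem by blast
        then show ?thesis
          using F_near [OF p, of x "ord p ! k"] that rank_nth [OF p that(1)] by simp
      qed
    qed (use ord [OF p] in simp_all)
    then show ?thesis
      by (simp add: D_def pt_def g_def [abs_def])
  qed
  ultimately show ?thesis
    by blast
qed

theorem theorem8p1:
  fixes C :: "('p, 'l) incidence"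
  assumes "incidence_structure C"
  shows "(\<exists>D f g. monotone_quasi_topological D \<and> incidence_isomorphism f g C D) \<and>
    (\<forall>ord :: 'p \<Rightarrow> 'l list.
       (\<forall>p\<in>points C. distinct (ord p) \<and> set (ord p) = {l. (p, l) \<in> inc C}) \<longrightarrow>
       (\<exists>D f g. monotone_quasi_topological D \<and> incidence_isomorphism f g C D \<and>
          (\<forall>p\<in>points C. appear_around (lines D) (f p) (map g (ord p)))))"
proof (intro conjI allI impI)
  have "\<exists>ls. distinct ls \<and> set ls = {l. (p, l) \<in> inc C}" for p
  proof -
    have "{l. (p, l) \<in> inc C} \<subseteq> lines C" "finite (lines C)"
      using assms by (auto simp: incidence_structure_def)
    then have "finite {l. (p, l) \<in> inc C}"
      by (rule finite_subset)
    then show ?thesis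
      using finite_distinct_list by blast
  qed
  then have "\<exists>ord. \<forall>p. distinct (ord p) \<and> set (ord p) = {l. (p, l) \<in> inc C}"
    by (intro choice allI)
  then obtain ord where "\<forall>p. distinct (ord p) \<and> set (ord p) = {l. (p, l) \<in> inc C}" ..
  then show "\<exists>D f g. monotone_quasi_topological D \<and> incidence_isomorphism f g C D"
    using realization_with_prescribed_orders [OF assms, of ord] by blast
next
  fix ord :: "'p \<Rightarrow> 'l list"
  assume "\<forall>p\<in>points C. distinct (ord p) \<and> set (ord p) = {l. (p, l) \<in> inc C}"
  then show "\<exists>D f g. monotone_quasi_topological D \<and> incidence_isomorphism f g C D \<and>
      (\<forall>p\<in>points C. appear_around (lines D) (f p) (map g (ord p)))"
    by (intro realization_with_prescribed_orders assms) blast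
qed

end
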